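(* If the costs of the projects are encoded in unary, then the weighted problems GreedyAV-CC\$AC (weighted constructive control by adding candidates) and GreedyAV-DC\$AC (weighted destructive control by adding candidates) can be solved in polynomial time for any tie-breaking order, even if the projects' weights are encoded in binary.
   Context: A participatory budgeting (PB) instance is a triple $E=(P,V,B)$, where $P$ is a finite set of projects, $V$ is a finite set of voters and $B\in\mathbb{N}$ is the budget. Each voter $v\in V$ has an approval set $A(v)$ of projects, and each project $p$ has a cost $\mathrm{cost}(p)\in\mathbb{N}_{\ge 1}$ with $\mathrm{cost}(p)\le B$. For a set $S$ of projects, $\mathrm{cost}(S)=\sum_{p\in S}\mathrm{cost}(p)$. A PB rule $f$ maps a PB instance $E$ to a set $f(E)\subseteq P$ with $\mathrm{cost}(f(E))\le B$; projects in $f(E)$ are called funded. Rules are resolute: ties are resolved by a given tie-breaking order (a linear order over all projects), which is given together with the instance and restricted to the projects present. GreedyAV: let $\mathrm{score}_{AV}(p)=|\{v\in V: p\in A(v)\}|$. Start with $W=\emptyset$ and process the projects in non-increasing order of $\mathrm{score}_{AV}$ (ties by the tie-breaking order). When project $p$ is processed, add it to $W$ if $\mathrm{cost}(W)+\mathrm{cost}(p)\le B$; otherwise skip it. Stop when all projects have been processed and output $W$. $f$-CC\$AC: given disjoint sets $P$ (standard projects) and $Q$ (spoiler projects), voters $V$ with approval sets $A(v)\subseteq P\cup Q$, costs for all projects in $P\cup Q$, a nonnegative integer weight $\omega(q)$ for every project $q$, a budget $B$, a nonnegative integer $r$ and a project $p\in P$ with $p\notin f((P,V,B))$ (approvals restricted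 to $P$), decide whether there is $S\subseteq Q$ with $\sum_{q\in S}\omega(q)\le r$ such that $p\in f((P\cup S,V,B))$ (approvals restricted to $P\cup S$). $f$-DC\$AC: the same input except that $p\in f((P,V,B))$; decide whether there is $S\subseteq Q$ with $\sum_{q\in S}\omega(q)\le r$ such that $p\notin f((P\cup S,V,B))$. *)

theory Defs
  imports Main "HOL-Computational_Algebra.Polynomial"
begin

section \<open>Participatory budgeting and GreedyAV\<close>

record ('p, 'v) pb_instance =
  projects :: "'p set"
  voters   :: "'v set"
  approves :: "'v \<Rightarrow> 'p set"
  cost     :: "'p \<Rightarrow> nat"
  budget   :: nat

definition wf_pb :: "('p, 'v) pb_instance \<Rightarrow> bool" where
  "wf_pb E \<longleftrightarrow> finite (projects E) \<and> finite (voters E) \<and>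
     (\<forall>v\<in>voters E. approves E v \<subseteq> projects E) \<and>
     (\<forall>p\<in>projects E. 1 \<le> cost E p \<and> cost E p \<le> budget E)"

text \<open>A tie-breaking order is a duplicate-free list of projects; projects that occur earlier win
  ties. A rule also receives this order, which may mention projects that are not present.\<close>

type_synonym ('p, 'v) pb_rule = "'p list \<Rightarrow> ('p, 'v) pb_instance \<Rightarrow> 'p set"

definition score_av :: "('p, 'v) pb_instance \<Rightarrow> 'p \<Rightarrow> nat" where
  "score_av E p = card {v \<in> voters E. p \<in> approves E v}"

text \<open>Since \<^const>\<open>sort_key\<close> is stable, projects with equal scores stay in tie-breaking order.\<close>

definition processing_order :: "'p list \<Rightarrow> ('p, 'v) pb_instance \<Rightarrow> 'p list" where
  "processing_order T E = sort_key (\<lambda>p. - int (score_av E p)) (filter (\<lambda>p. p \<in> projects E) T)"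

definition greedy_step :: "('p, 'v) pb_instance \<Rightarrow> 'p \<Rightarrow> 'p set \<Rightarrow> 'p set" where
  "greedy_step E p W = (if sum (cost E) W + cost E p \<le> budget E then insert p W else W)"

definition greedy_av :: "('p, 'v) pb_rule" where
  "greedy_av T E = fold (greedy_step E) (processing_order T E) {}"


section \<open>Weighted control by adding projects\<close>

text \<open>The inherited field \<^const>\<open>projects\<close> holds the standard projects only, whereas approval sets,
  costs, weights and the tie-breaking order range over standard and spoiler projects.\<close>

record ('p, 'v) control_input = "('p, 'v) pb_instance" +
  spoilers :: "'p set"
  weight   :: "'p \<Rightarrow> nat"
  limit    :: nat
  target   :: 'p
  tie      :: "'p list"

definition with_spoilers :: "('p, 'v) control_input \<Rightarrow> 'p set \<Rightarrow> ('p, 'v) pb_instance" where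
  "with_spoilers I S =
     \<lparr> projects = projects I \<union> S,
       voters   = voters I,
       approves = (\<lambda>v. approves I v \<inter> (projects I \<union> S)),
       cost     = cost I,
       budget   = budget I \<rparr>"

definition wf_control :: "('p, 'v) control_input \<Rightarrow> bool" where
  "wf_control I \<longleftrightarrow>
     projects I \<inter> spoilers I = {} \<and>
     wf_pb (with_spoilers I (spoilers I)) \<and>
     (\<forall>v\<in>voters I. approves I v \<subseteq> projects I \<union> spoilers I) \<and>
     target I \<in> projects I \<and>
     distinct (tie I) \<and> set (tie I) = projects I \<union> spoilers I"

definition cc_ac_inputs :: "('p, 'v) pb_rule \<Rightarrow> ('p, 'v) control_input set" where
  "cc_ac_inputs f = {I. wf_control I \<and> target I \<notin> f (tie I) (with_spoilers I {})}"

definition cc_ac :: "('p, 'v) pb_rule \<Rightarrow> ('p, 'v) control_input \<Rightarrow> bool" where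
  "cc_ac f I \<longleftrightarrow> (\<exists>S \<subseteq> spoilers I. sum (weight I) S \<le> limit I \<and>
     target I \<in> f (tie I) (with_spoilers I S))"

definition dc_ac_inputs :: "('p, 'v) pb_rule \<Rightarrow> ('p, 'v) control_input set" where
  "dc_ac_inputs f = {I. wf_control I \<and> target I \<in> f (tie I) (with_spoilers I {})}"

definition dc_ac :: "('p, 'v) pb_rule \<Rightarrow> ('p, 'v) control_input \<Rightarrow> bool" where
  "dc_ac f I \<longleftrightarrow> (\<exists>S \<subseteq> spoilers I. sum (weight I) S \<le> limit I \<and>
     target I \<notin> f (tie I) (with_spoilers I S))"


section \<open>Encoding of inputs as words\<close>

datatype symbol = Bit bool | Sep

text \<open>Most significant bit first, no leading zeros.\<close>

fun bits :: "nat \<Rightarrow> bool list" where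
  "bits n = (if n = 0 then [] else bits (n div 2) @ [odd n])"

declare bits.simps [simp del]

definition binary :: "nat \<Rightarrow> symbol list" where
  "binary n = map Bit (bits n) @ [Sep]"

definition unary :: "nat \<Rightarrow> symbol list" where
  "unary n = replicate n (Bit True) @ [Sep]"

text \<open>Costs are written in unary; weights, the budget and the weight limit in binary.
  Projects are listed in tie-breaking order, which is how this order is communicated;
  project and voter names do not occur in the word. Each voter is a row of the approval matrix.\<close>

definition encode_project :: "('p, 'v) control_input \<Rightarrow> 'p \<Rightarrow> symbol list" where
  "encode_project I q =
     [Bit (q \<in> projects I), Bit (q = target I)] @ unary (cost I q) @ binary (weight I q)"

definition encode_voter :: "('p, 'v) control_input \<Rightarrow> 'v \<Rightarrow> symbol list" where
  "encode_voter I v = map (\<lambda>q. Bit (q \<in> approves I v)) (tie I) @ [Sep]"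

text \<open>A relation rather than a function because the voters may be listed in any order.\<close>

definition encodes :: "('p, 'v) control_input \<Rightarrow> symbol list \<Rightarrow> bool" where
  "encodes I w \<longleftrightarrow> (\<exists>vs. distinct vs \<and> set vs = voters I \<and>
     w = binary (budget I) @ binary (limit I) @
         concat (map (encode_project I) (tie I)) @ [Sep] @
         concat (map (encode_voter I) vs))"


section \<open>Polynomial time on random access machines with logarithmic cost\<close>

text \<open>The machine has registers \<open>0, 1, 2, \<dots>\<close> holding natural numbers, all initially \<open>0\<close>, and
  random access to a read-only input word; subtraction is truncated. An instruction is charged the
  lengths of all numbers it handles (register numbers, addresses and contents), so that
  time is polynomially related to that of Turing machines.\<close>

datatype instr =
    Const nat nat
  | Add nat nat nat
  | Sub nat nat nat
  | Load nat nat
  | Store nat nat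
  | Input nat nat
  | Jump nat
  | JumpZero nat nat

type_synonym config = "nat \<times> (nat \<Rightarrow> nat)"

text \<open>The value \<open>0\<close> signals a position beyond the end of the input.\<close>

definition input_at :: "symbol list \<Rightarrow> nat \<Rightarrow> nat" where
  "input_at w i = (if i < length w
     then (case w ! i of Bit b \<Rightarrow> (if b then 2 else 1) | Sep \<Rightarrow> 3) else 0)"

fun step :: "symbol list \<Rightarrow> instr \<Rightarrow> config \<Rightarrow> config" where
  "step w (Const a n)    (pc, m) = (Suc pc, m(a := n))"
| "step w (Add a b c)    (pc, m) = (Suc pc, m(a := m b + m c))"
| "step w (Sub a b c)    (pc, m) = (Suc pc, m(a := m b - m c))"
| "step w (Load a b)     (pc, m) = (Suc pc, m(a := m (m b)))"
| "step w (Store a b)    (pc, m) = (Suc pc, m(m a := m b))"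
| "step w (Input a b)    (pc, m) = (Suc pc, m(a := input_at w (m b)))"
| "step w (Jump l)       (pc, m) = (l, m)"
| "step w (JumpZero a l) (pc, m) = (if m a = 0 then l else Suc pc, m)"

definition len :: "nat \<Rightarrow> nat" where
  "len n = max 1 (length (bits n))"

fun instr_cost :: "instr \<Rightarrow> (nat \<Rightarrow> nat) \<Rightarrow> nat" where
  "instr_cost (Const a n)    m = len a + len n"
| "instr_cost (Add a b c)    m = len a + len b + len c + len (m b) + len (m c)"
| "instr_cost (Sub a b c)    m = len a + len b + len c + len (m b) + len (m c)"
| "instr_cost (Load a b)     m = len a + len b + len (m b) + len (m (m b))"
| "instr_cost (Store a b)    m = len a + len b + len (m a) + len (m b)"
| "instr_cost (Input a b)    m = len a + len b + len (m b)"
| "instr_cost (Jump l)       m = len l"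
| "instr_cost (JumpZero a l) m = len a + len l + len (m a)"

text \<open>\<open>exec P w c t c'\<close>: program \<open>P\<close> started in \<open>c\<close> on input \<open>w\<close> halts in \<open>c'\<close> after time \<open>t\<close>.
  Halting means that the program counter has left the program.\<close>

inductive exec :: "instr list \<Rightarrow> symbol list \<Rightarrow> config \<Rightarrow> nat \<Rightarrow> config \<Rightarrow> bool"
  for P :: "instr list" and w :: "symbol list" where
  halt: "length P \<le> pc \<Longrightarrow> exec P w (pc, m) 0 (pc, m)"
| run: "pc < length P \<Longrightarrow> exec P w (step w (P ! pc) (pc, m)) t c \<Longrightarrow>
    exec P w (pc, m) (instr_cost (P ! pc) m + t) c"

text \<open>A decision problem is given by its inputs \<open>D\<close>, the property \<open>Y\<close> to be decided and the encoding
  relation \<open>enc\<close>. The answer is yes iff register \<open>0\<close> is nonzero upon halting.\<close>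

definition poly_time_solvable ::
  "'i set \<Rightarrow> ('i \<Rightarrow> bool) \<Rightarrow> ('i \<Rightarrow> symbol list \<Rightarrow> bool) \<Rightarrow> bool" where
  "poly_time_solvable D Y enc \<longleftrightarrow>
     (\<exists>(P :: instr list) (b :: nat poly). \<forall>I\<in>D. \<forall>w. enc I w \<longrightarrow>
        (\<exists>t pc m. exec P w (0, \<lambda>_. 0) t (pc, m) \<and> t \<le> poly b (length w) \<and>
                  (m 0 \<noteq> 0 \<longleftrightarrow> Y I)))"

end

theory Submission imports Defs begin

text \<open>Scores do not depend on the added spoilers, so GreedyAV on \<open>P \<union> S\<close> runs through one fixed order
  of \<open>P \<union> Q\<close> and ignores the absent projects. All the past of such a run that matters is the amount
  spent, which is at most the sum of all costs and hence smaller than the length of the input. A table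
  that maps each amount to the least weight of spoilers leading to it can thus be updated project by
  project; a spoiler that is added but does not fit is useless. When the target is reached, the table
  shows whether it can be funded (or skipped) within the weight limit, and spoilers processed
  afterwards are irrelevant.

  For the running time, the algorithm is written in a loop language whose only loop runs over the
  positions of the input word. Programs then denote total functions, and their number of machine steps
  is bounded by a polynomial read off the syntax. A step at most doubles the largest number in
  memory, so numbers stay polynomially long and logarithmic costs are polynomial as well.\<close>

section \<open>Running time and number of steps\<close>

text \<open>The budget is binary and may be exponential in the length of the word, so the table
  cannot be indexed up to it; the unary costs alone bound the useful indices. Weights may be binary
  because they occur only as table contents, never as indices. Keeping just the least weight for
  each amount is enough because the limit is an upper bound on the weight, although funding the
  target is not monotone in the set of added spoilers. The single loop form dictates the rest.
  Sorting by score becomes a bucket sort: one pass over the projects for each possible score. The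
  machine has neither multiplication nor comparison, so array addresses come from repeated doubling,
  and comparisons are truncated subtractions tested for zero.\<close>

lemma length_bits_le: "n < 2 ^ k \<Longrightarrow> length (bits n) \<le> k"
proof (induction k arbitrary: n)
  case 0
  then show ?case by (simp add: bits.simps)
next
  case (Suc k)
  then have "length (bits (n div 2)) \<le> k" by auto
  then show ?case by (subst bits.simps) auto
qed

lemma len_le: "n < 2 ^ k \<Longrightarrow> 0 < k \<Longrightarrow> len n \<le> k"
  using length_bits_le[of n k] by (simp add: len_def)

text \<open>A crude common bound for all literals of an instruction: they are charged by length, and
  \<open>Const\<close> also writes one to memory. Only a constant per program is needed, so a sum
  will do.\<close>

fun operand_sum :: "instr \<Rightarrow> nat" where
  "operand_sum (Const a n) = a + n"
| "operand_sum (Add a b c) = a + b + c"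
| "operand_sum (Sub a b c) = a + b + c"
| "operand_sum (Load a b) = a + b"
| "operand_sum (Store a b) = a + b"
| "operand_sum (Input a b) = a + b"
| "operand_sum (Jump l) = l"
| "operand_sum (JumpZero a l) = a + l"

lemma input_at_le: "input_at w i \<le> 3"
  by (simp add: input_at_def split: symbol.split)

lemma input_at_eq_0_iff: "input_at w i = 0 \<longleftrightarrow> length w \<le> i"
  by (simp add: input_at_def split: symbol.split)

text \<open>At most five lengths are charged (by \<open>Add\<close> and \<open>Sub\<close>), and
  each is at most \<open>k + K\<close>: register contents by assumption, literals because n < 2 ^
  n.\<close>

lemma instr_cost_le:
  assumes "operand_sum i \<le> K" "\<And>r. m r < 2 ^ (k + K)" "0 < K"
  shows "instr_cost i m \<le> 5 * (k + K)"
proof -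
  have m: "len (m r) \<le> k + K" for r
    using assms by (intro len_le) auto
  have c: "len n \<le> k + K" if "n \<le> K" for n
  proof (rule len_le)
    have "n < 2 ^ n" by simp
    also have "(2::nat) ^ n \<le> 2 ^ (k + K)" using that by (intro power_increasing) auto
    finally show "n < 2 ^ (k + K)" .
  qed (use assms in auto)
  show ?thesis
  proof (cases i)
    case (Const a n)
    then show ?thesis using assms(1) c[of a] c[of n] by simp
  next
    case (Add a b d)
    then show ?thesis using assms(1) c[of a] c[of b] c[of d] m[of b] m[of d] by simp
  next
    case (Sub a b d)
    then show ?thesis using assms(1) c[of a] c[of b] c[of d] m[of b] m[of d] by simp
  next
    case (Load a b)
    then show ?thesis using assms(1) c[of a] c[of b] m[of b] m[of "m b"] by simp
  next
    case (Store a b)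
    then show ?thesis using assms(1) c[of a] c[of b] m[of a] m[of b] by simp
  next
    case (Input a b)
    then show ?thesis using assms(1) c[of a] c[of b] m[of b] by simp
  next
    case (Jump l)
    then show ?thesis using assms(1) c[of l] by simp
  next
    case (JumpZero a l)
    then show ?thesis using assms(1) c[of a] c[of l] m[of a] by simp
  qed
qed

lemma step_less:
  assumes "operand_sum i \<le> K" "\<And>r. m r < 2 ^ (k + K)" "1 < K"
  shows "snd (step w i (pc, m)) r < 2 ^ (Suc k + K)"
proof -
  have dbl: "(2::nat) ^ (Suc k + K) = 2 ^ (k + K) + 2 ^ (k + K)" by simp
  have n: "n < 2 ^ (Suc k + K)" if "n \<le> K" for n
  proof -
    have "n < 2 ^ n" by simp
    also have "(2::nat) ^ n \<le> 2 ^ (Suc k + K)" using that by (intro power_increasing) auto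
    finally show ?thesis .
  qed
  \<comment> \<open>\<open>Input\<close> can write the value 3, so the exponent must be at least
    2.\<close>
  have "(2::nat) ^ 2 \<le> 2 ^ (k + K)" using assms(3) by (intro power_increasing) auto
  then have "input_at w j < 2 ^ (Suc k + K)" for j
    using input_at_le[of w j] by simp
  moreover have "m r < 2 ^ (Suc k + K)" for r
    using assms(2)[of r] by simp
  moreover have "m a + m b < 2 ^ (Suc k + K)" for a b
    unfolding dbl using assms(2) by (intro add_strict_mono)
  moreover have "m a - m b < 2 ^ (Suc k + K)" for a b
    using assms(2)[of a] by (simp add: less_imp_diff_less)
  ultimately show ?thesis
    using assms(1) n by (cases i) (auto simp del: power_Suc add_Suc)
qed

text \<open>Idling after a halt makes iteration total, so that a run can be described by a power of
  one function.\<close>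

definition advance :: "instr list \<Rightarrow> symbol list \<Rightarrow> config \<Rightarrow> config" where
  "advance P w c = (if fst c < length P then step w (P ! fst c) c else c)"

text \<open>In the induction \<open>k\<close> grows by one per step while \<open>T\<close> shrinks
  by one, so \<open>k + T\<close> is constant and every step costs at most 5 * (k + T + K).\<close>

lemma exec_if_halts:
  assumes "(advance P w ^^ T) (pc, m) = (pc', m')" "length P \<le> pc'"
    "\<And>r. m r < 2 ^ (k + K)" "1 < K" "\<And>i. i \<in> set P \<Longrightarrow> operand_sum i \<le> K"
  shows "\<exists>t. exec P w (pc, m) t (pc', m') \<and> t \<le> T * (5 * (k + T + K))"
  using assms(1,3)
proof (induction T arbitrary: pc m k)
  case 0
  then show ?case using assms(2) by (auto intro: exec.halt)
next
  case (Suc T)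
  show ?case
  proof (cases "pc < length P")
    case False
    then have idle: "advance P w (pc, m) = (pc, m)" by (simp add: advance_def)
    have "(advance P w ^^ n) (pc, m) = (pc, m)" for n
      by (induction n) (auto simp: idle)
    then have "(pc, m) = (pc', m')" using Suc.prems by metis
    then show ?thesis using assms(2) by (auto intro: exec.halt)
  next
    case True
    obtain pc1 m1 where c1: "step w (P ! pc) (pc, m) = (pc1, m1)" by fastforce
    have i: "operand_sum (P ! pc) \<le> K" using True assms(5) by simp
    have "advance P w (pc, m) = (pc1, m1)"
      using True c1 by (simp add: advance_def)
    then have "(advance P w ^^ T) (pc1, m1) = (pc', m')"
      using Suc.prems(1) by (simp add: funpow_Suc_right del: funpow.simps)
    moreover have "m1 r < 2 ^ (Suc k + K)" for r
      using step_less[where m = m and w = w and pc = pc and r = r, OF i Suc.prems(2) assms(4)]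
      unfolding c1 by simp
    ultimately obtain t where t: "exec P w (pc1, m1) t (pc', m')" "t \<le> T * (5 * (Suc k + T + K))"
      using Suc.IH by blast
    have "exec P w (pc, m) (instr_cost (P ! pc) m + t) (pc', m')"
    proof (rule exec.run[OF True])
      show "exec P w (step w (P ! pc) (pc, m)) t (pc', m')"
        unfolding c1 by (rule t(1))
    qed
    moreover have "instr_cost (P ! pc) m \<le> 5 * (k + K)"
      using i Suc.prems(2) assms(4) by (intro instr_cost_le) auto
    then have "instr_cost (P ! pc) m + t \<le> Suc T * (5 * (k + Suc T + K))"
      using t(2) by (simp add: algebra_simps)
    ultimately show ?thesis by blast
  qed
qed

section \<open>A loop language\<close>

text \<open>A scalar is the element \<open>0\<close> of an array.\<close>

datatype exp = N nat | Arr nat exp | In exp | Plus exp exp | Minus exp exp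

datatype com = Skip | Asg nat exp exp | Seq com com | If exp com com | For nat com

type_synonym store = "nat \<times> nat \<Rightarrow> nat"

primrec val :: "symbol list \<Rightarrow> store \<Rightarrow> exp \<Rightarrow> nat" where
  "val w s (N n) = n"
| "val w s (Arr a e) = s (a, val w s e)"
| "val w s (In e) = input_at w (val w s e)"
| "val w s (Plus e f) = val w s e + val w s f"
| "val w s (Minus e f) = val w s e - val w s f"

text \<open>The final value \<open>length w\<close> of a loop variable is what compiled code leaves
  behind: its loop stops at the first position where the input reads 0.\<close>

primrec den :: "symbol list \<Rightarrow> com \<Rightarrow> store \<Rightarrow> store" where
  "den w Skip s = s"
| "den w (Asg a e f) s = s((a, val w s e) := val w s f)"
| "den w (Seq c d) s = den w d (den w c s)"
| "den w (If e c d) s = (if val w s e \<noteq> 0 then den w c s else den w d s)"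
| "den w (For x c) s =
     (fold (\<lambda>i s. den w c (s((x, 0) := i))) [0..<length w] s)((x, 0) := length w)"

primrec assigned :: "com \<Rightarrow> nat set" where
  "assigned Skip = {}"
| "assigned (Asg a e f) = {a}"
| "assigned (Seq c d) = assigned c \<union> assigned d"
| "assigned (If e c d) = assigned c \<union> assigned d"
| "assigned (For x c) = insert x (assigned c)"

lemma den_unassigned: "a \<notin> assigned c \<Longrightarrow> den w c s (a, i) = s (a, i)"
proof (induction c arbitrary: s)
  case (For x c)
  have "fold (\<lambda>i s. den w c (s((x, 0) := i))) xs s (a, i) = s (a, i)" for xs
    using For by (induction xs arbitrary: s) auto
  then show ?case using For.prems by simp
qed auto

text \<open>The Hoare rule for loops, with the invariant indexed by the number of completed rounds.
  \<open>Exit\<close> is a separate case because leaving the loop overwrites the counter.\<close>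

lemma For_induct [consumes 0, case_names 0 Suc Exit]:
  assumes "R 0 s"
    "\<And>i s. i < length w \<Longrightarrow> R i s \<Longrightarrow> R (Suc i) (den w c (s((x, 0) := i)))"
    "\<And>s. R (length w) s \<Longrightarrow> R' (s((x, 0) := length w))"
  shows "R' (den w (For x c) s)"
proof -
  have "R n (fold (\<lambda>i s. den w c (s((x, 0) := i))) [0..<n] s)" if "n \<le> length w" for n
    using that by (induction n) (auto intro: assms)
  then show ?thesis using assms(3) by simp
qed

section \<open>Compilation\<close>

text \<open>Element \<open>i\<close> of array \<open>a < 32\<close> lives in register \<open>a + 64 * i\<close>; the registers from \<open>32\<close> to \<open>63\<close>
  are the evaluation stack.\<close>

definition address_of :: "nat \<Rightarrow> nat \<Rightarrow> instr list" where
  "address_of d a = replicate 6 (Add d d d) @ [Const (Suc d) a, Add d d (Suc d)]"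

primrec compile_exp :: "nat \<Rightarrow> exp \<Rightarrow> instr list" where
  "compile_exp d (N n) = [Const d n]"
| "compile_exp d (Arr a e) = compile_exp d e @ address_of d a @ [Load d d]"
| "compile_exp d (In e) = compile_exp d e @ [Input d d]"
| "compile_exp d (Plus e f) = compile_exp d e @ compile_exp (Suc d) f @ [Add d d (Suc d)]"
| "compile_exp d (Minus e f) = compile_exp d e @ compile_exp (Suc d) f @ [Sub d d (Suc d)]"

text \<open>The stack must stay below register 64, where the array elements of positive index begin.
  \<open>Arr\<close> needs one register more, as scratch for \<open>address_of\<close>.\<close>

primrec ok_exp :: "nat \<Rightarrow> exp \<Rightarrow> bool" where
  "ok_exp d (N n) \<longleftrightarrow> d < 64"
| "ok_exp d (Arr a e) \<longleftrightarrow> a < 32 \<and> Suc d < 64 \<and> ok_exp d e"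
| "ok_exp d (In e) \<longleftrightarrow> ok_exp d e"
| "ok_exp d (Plus e f) \<longleftrightarrow> ok_exp d e \<and> ok_exp (Suc d) f"
| "ok_exp d (Minus e f) \<longleftrightarrow> ok_exp d e \<and> ok_exp (Suc d) f"

text \<open>Jump targets are absolute, hence the load address \<open>l\<close>. The loop test reads
  the input at the counter, which yields 0 exactly beyond the end, so no length has to be known in
  advance.\<close>

primrec compile :: "nat \<Rightarrow> com \<Rightarrow> instr list" where
  "compile l Skip = []"
| "compile l (Asg a e f) =
     compile_exp 32 e @ address_of 32 a @ compile_exp 33 f @ [Store 32 33]"
| "compile l (Seq c d) = (let C = compile l c in C @ compile (l + length C) d)"
| "compile l (If e c d) =
     (let E = compile_exp 32 e;
          C = compile (l + length E + 1) c;
          l' = l + length E + length C + 2;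
          D = compile l' d
      in E @ [JumpZero 32 l'] @ C @ [Jump (l' + length D)] @ D)"
| "compile l (For x c) =
     (let C = compile (l + 3) c
      in [Const x 0, Input 32 x, JumpZero 32 (l + length C + 6)] @ C @
         [Const 32 1, Add x x 32, Jump (l + 1)])"

text \<open>A body must not assign its own loop variable: the machine increments the register,
  whereas \<open>den\<close> sets the variable afresh in each round.\<close>

primrec ok :: "com \<Rightarrow> bool" where
  "ok Skip \<longleftrightarrow> True"
| "ok (Asg a e f) \<longleftrightarrow> a < 32 \<and> ok_exp 32 e \<and> ok_exp 33 f"
| "ok (Seq c d) \<longleftrightarrow> ok c \<and> ok d"
| "ok (If e c d) \<longleftrightarrow> ok_exp 32 e \<and> ok c \<and> ok d"
| "ok (For x c) \<longleftrightarrow> x < 32 \<and> x \<notin> assigned c \<and> ok c"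

text \<open>Both branches of a conditional are counted. A loop pays 1 for initialization and 2 for
  the final test; each round adds to the body 2 for the test and 3 for increment and jump
  back.\<close>

primrec steps :: "com \<Rightarrow> nat poly" where
  "steps Skip = 0"
| "steps (Asg a e f) = [:length (compile 0 (Asg a e f)):]"
| "steps (Seq c d) = steps c + steps d"
| "steps (If e c d) = [:length (compile_exp 32 e) + 2:] + steps c + steps d"
| "steps (For x c) = [:3:] + [:0, 1:] * (steps c + [:5:])"

section \<open>Correctness and step count of compiled code\<close>

definition code_at :: "instr list \<Rightarrow> nat \<Rightarrow> instr list \<Rightarrow> bool" where
  "code_at P l C \<longleftrightarrow> (\<forall>i<length C. l + i < length P \<and> P ! (l + i) = C ! i)"

lemma code_at_Nil [simp]: "code_at P l []"
  by (simp add: code_at_def)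

lemma code_at_Cons [simp]:
  "code_at P l (i # C) \<longleftrightarrow> l < length P \<and> P ! l = i \<and> code_at P (Suc l) C"
  by (force simp: code_at_def All_less_Suc2)

lemma code_at_append [simp]:
  "code_at P l (C @ D) \<longleftrightarrow> code_at P l C \<and> code_at P (l + length C) D"
  by (induction C arbitrary: l) auto

definition reaches :: "instr list \<Rightarrow> symbol list \<Rightarrow> nat \<Rightarrow> config \<Rightarrow> config \<Rightarrow> bool" where
  "reaches P w n c c' \<longleftrightarrow> (advance P w ^^ n) c = c'"

lemma reaches_refl [simp]: "reaches P w 0 c c' \<longleftrightarrow> c = c'"
  by (simp add: reaches_def)

lemma reaches_trans: "reaches P w n c c' \<Longrightarrow> reaches P w n' c' c'' \<Longrightarrow> reaches P w (n + n') c c''"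
  by (simp add: reaches_def add.commute[of n] funpow_add)

lemma reaches_step:
  "pc < length P \<Longrightarrow> reaches P w (Suc n) (pc, m) c \<longleftrightarrow> reaches P w n (step w (P ! pc) (pc, m)) c"
  by (simp add: reaches_def advance_def funpow_Suc_right del: funpow.simps)

definition represents :: "(nat \<Rightarrow> nat) \<Rightarrow> store \<Rightarrow> bool" where
  "represents m s \<longleftrightarrow> (\<forall>a<32. \<forall>i. m (a + 64 * i) = s (a, i))"

lemma reaches_address_of:
  assumes "code_at P l (address_of d a)"
  shows "reaches P w 8 (l, m) (l + 8, m(d := a + 64 * m d, Suc d := a))"
proof -
  \<comment> \<open>Multiplication by 64 = 2 ^ 6 is done by six doublings.\<close>
  have "reaches P w n (l, m) (l + n, m(d := 2 ^ n * m d))"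
    if "code_at P l (replicate n (Add d d d))" for n l m
    using that
  proof (induction n arbitrary: l m)
    case (Suc n)
    have "2 ^ Suc n * m d = 2 ^ n * (m d + m d)" by simp
    then show ?case using Suc.IH[of "Suc l" "m(d := m d + m d)"] Suc.prems
      by (simp add: reaches_step fun_upd_def del: power_Suc cong: if_cong)
  qed simp
  from this[of l 6 m] have "reaches P w 6 (l, m) (l + 6, m(d := 64 * m d))"
    using assms by (simp add: address_of_def)
  moreover have "reaches P w 2 (l + 6, m(d := 64 * m d))
      (l + 8, m(d := a + 64 * m d, Suc d := a))"
    using assms by (simp add: address_of_def numeral_2_eq_2 reaches_step fun_eq_iff)
  ultimately show ?thesis by (auto dest: reaches_trans)
qed

lemma ok_exp_less: "ok_exp d e \<Longrightarrow> d < 64"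
  by (induction e arbitrary: d) auto

lemma representsD: "represents m s \<Longrightarrow> a < 32 \<Longrightarrow> m (a + 64 * i) = s (a, i)"
  by (simp add: represents_def)

lemma represents_scalar: "represents m s \<Longrightarrow> a < 32 \<Longrightarrow> m a = s (a, 0)"
  using representsD[of m s a 0] by simp

lemma represents_cong:
  assumes "represents m s" "\<And>r. r < 32 \<or> 64 \<le> r \<Longrightarrow> m' r = m r"
  shows "represents m' s"
  unfolding represents_def
proof (intro allI impI)
  fix a i :: nat
  assume "a < 32"
  then have "a + 64 * i < 32 \<or> 64 \<le> a + 64 * i" by (cases i) auto
  then show "m' (a + 64 * i) = s (a, i)"
    using assms \<open>a < 32\<close> by (simp add: represents_def)
qed

lemma address_inj: "a < 32 \<Longrightarrow> b < 32 \<Longrightarrow> a + 64 * i = b + 64 * j \<longleftrightarrow> a = b \<and> i = (j::nat)"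
proof -
  assume "a < 32" "b < 32"
  then have "(a + 64 * i) mod 64 = a" "(b + 64 * j) mod 64 = b" by simp_all
  then show ?thesis by (metis add_left_cancel mult_cancel1 zero_neq_numeral)
qed

lemma represents_update:
  assumes "represents m s" "a < 32"
  shows "represents (m(a + 64 * i := v)) (s((a, i) := v))"
  using assms by (auto simp: represents_def address_inj)

text \<open>Expressions contain no jumps, so the step count is the code length. Registers below
  \<open>d\<close> are preserved because they hold pending operands as well as scalars; those from
  64 on hold the remaining array elements.\<close>

lemma reaches_compile_exp:
  assumes "code_at P l (compile_exp d e)" "represents m s" "ok_exp d e" "32 \<le> d"
  shows "\<exists>m'. reaches P w (length (compile_exp d e)) (l, m) (l + length (compile_exp d e), m') \<and>
    m' d = val w s e \<and> (\<forall>r. r < d \<or> 64 \<le> r \<longrightarrow> m' r = m r)"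
  using assms
proof (induction e arbitrary: l d m)
  case (N n)
  then have "reaches P w 1 (l, m) (l + 1, m(d := n))" by (simp add: reaches_step)
  then show ?case using N.prems by fastforce
next
  case (Arr a e)
  let ?n = "length (compile_exp d e)"
  obtain m1 where m1: "reaches P w ?n (l, m) (l + ?n, m1)" "m1 d = val w s e"
      "\<And>r. r < d \<or> 64 \<le> r \<Longrightarrow> m1 r = m r"
    using Arr.IH[of l d m] Arr.prems by auto
  define m2 where "m2 = m1(d := a + 64 * m1 d, Suc d := a)"
  \<comment> \<open>The address lies outside the stack, so the scratch writes of
    \<open>address_of\<close> cannot have changed the cell to be loaded.\<close>
  have "a + 64 * m1 d < 32 \<or> 64 \<le> a + 64 * m1 d"
    using Arr.prems by (cases "m1 d") auto
  then have at: "m2 (m2 d) = s (a, val w s e)"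
    using Arr.prems m1 by (auto simp: representsD m2_def)
  have "reaches P w 8 (l + ?n, m1) (l + ?n + 8, m2)"
    unfolding m2_def using Arr.prems by (intro reaches_address_of) simp
  moreover have "l + ?n + 8 < length P" "P ! (l + ?n + 8) = Load d d"
    using Arr.prems by (simp_all add: address_of_def ac_simps)
  then have "reaches P w 1 (l + ?n + 8, m2) (l + ?n + 9, m2(d := m2 (m2 d)))"
    by (simp add: reaches_step)
  ultimately have "reaches P w (?n + 8 + 1) (l, m) (l + ?n + 9, m2(d := m2 (m2 d)))"
    using m1(1) reaches_trans by blast
  moreover have "length (compile_exp d (Arr a e)) = ?n + 8 + 1"
    by (simp add: address_of_def)
  moreover have "\<forall>r. r < d \<or> 64 \<le> r \<longrightarrow> (m2(d := m2 (m2 d))) r = m r"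
    using Arr.prems m1(3) by (simp add: m2_def)
  moreover have "(m2(d := m2 (m2 d))) d = val w s (Arr a e)"
    using at by simp
  ultimately show ?case by (metis add.assoc one_add_one numeral_Bit1 numeral_plus_one semiring_norm(5))
next
  case (In e)
  let ?n = "length (compile_exp d e)"
  obtain m1 where m1: "reaches P w ?n (l, m) (l + ?n, m1)" "m1 d = val w s e"
      "\<And>r. r < d \<or> 64 \<le> r \<Longrightarrow> m1 r = m r"
    using In.IH[of l d m] In.prems by auto
  let ?m = "m1(d := input_at w (m1 d))"
  have "reaches P w 1 (l + ?n, m1) (l + ?n + 1, ?m)"
    using In.prems by (simp add: reaches_step)
  then have "reaches P w (?n + 1) (l, m) (l + ?n + 1, ?m)"
    using m1(1) reaches_trans by blast
  moreover have "length (compile_exp d (In e)) = ?n + 1" by simp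
  moreover have "\<forall>r. r < d \<or> 64 \<le> r \<longrightarrow> ?m r = m r"
    using In.prems m1(3) ok_exp_less[of d e] by simp
  moreover have "?m d = val w s (In e)" using m1(2) by simp
  ultimately show ?case by (metis add.assoc)
next
  case (Plus e f)
  let ?n = "length (compile_exp d e)" and ?k = "length (compile_exp (Suc d) f)"
  obtain m1 where m1: "reaches P w ?n (l, m) (l + ?n, m1)" "m1 d = val w s e"
      "\<And>r. r < d \<or> 64 \<le> r \<Longrightarrow> m1 r = m r"
    using Plus.IH(1)[of l d m] Plus.prems by auto
  have "represents m1 s"
    using Plus.prems by (intro represents_cong[OF Plus.prems(2)] m1) auto
  then obtain m2 where m2: "reaches P w ?k (l + ?n, m1) (l + ?n + ?k, m2)"
      "m2 (Suc d) = val w s f" "\<And>r. r < Suc d \<or> 64 \<le> r \<Longrightarrow> m2 r = m1 r"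
    using Plus.IH(2)[of "l + ?n" "Suc d" m1] Plus.prems by auto
  let ?m = "m2(d := m2 d + m2 (Suc d))"
  have "reaches P w 1 (l + ?n + ?k, m2) (l + ?n + ?k + 1, ?m)"
    using Plus.prems by (simp add: reaches_step ac_simps)
  then have "reaches P w (?n + ?k + 1) (l, m) (l + ?n + ?k + 1, ?m)"
    using m1(1) m2(1) reaches_trans by blast
  moreover have "length (compile_exp d (Plus e f)) = ?n + ?k + 1" by simp
  moreover have "\<forall>r. r < d \<or> 64 \<le> r \<longrightarrow> ?m r = m r"
    using Plus.prems m1(3) m2(3) ok_exp_less[of d e] by simp
  moreover have "?m d = val w s (Plus e f)" using m1(2) m2(2,3) by simp
  ultimately show ?case by (metis add.assoc)
next
  case (Minus e f)
  let ?n = "length (compile_exp d e)" and ?k = "length (compile_exp (Suc d) f)"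
  obtain m1 where m1: "reaches P w ?n (l, m) (l + ?n, m1)" "m1 d = val w s e"
      "\<And>r. r < d \<or> 64 \<le> r \<Longrightarrow> m1 r = m r"
    using Minus.IH(1)[of l d m] Minus.prems by auto
  have "represents m1 s"
    using Minus.prems by (intro represents_cong[OF Minus.prems(2)] m1) auto
  then obtain m2 where m2: "reaches P w ?k (l + ?n, m1) (l + ?n + ?k, m2)"
      "m2 (Suc d) = val w s f" "\<And>r. r < Suc d \<or> 64 \<le> r \<Longrightarrow> m2 r = m1 r"
    using Minus.IH(2)[of "l + ?n" "Suc d" m1] Minus.prems by auto
  let ?m = "m2(d := m2 d - m2 (Suc d))"
  have "reaches P w 1 (l + ?n + ?k, m2) (l + ?n + ?k + 1, ?m)"
    using Minus.prems by (simp add: reaches_step ac_simps)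
  then have "reaches P w (?n + ?k + 1) (l, m) (l + ?n + ?k + 1, ?m)"
    using m1(1) m2(1) reaches_trans by blast
  moreover have "length (compile_exp d (Minus e f)) = ?n + ?k + 1" by simp
  moreover have "\<forall>r. r < d \<or> 64 \<le> r \<longrightarrow> ?m r = m r"
    using Minus.prems m1(3) m2(3) ok_exp_less[of d e] by simp
  moreover have "?m d = val w s (Minus e f)" using m1(2) m2(2,3) by simp
  ultimately show ?case by (metis add.assoc)
qed

lemma reaches_comp:
  assumes "code_at P l (compile l c)" "represents m s" "ok c"
  shows "\<exists>n m'. reaches P w n (l, m) (l + length (compile l c), m') \<and>
    n \<le> poly (steps c) (length w) \<and> represents m' (den w c s)"
  using assms
proof (induction c arbitrary: l m s)
  case Skip
  then show ?case by auto
next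
  case (Asg a e f)
  let ?n = "length (compile_exp 32 e)" and ?k = "length (compile_exp 33 f)"
  obtain m1 where m1: "reaches P w ?n (l, m) (l + ?n, m1)" "m1 32 = val w s e"
      "\<And>r. r < 32 \<or> 64 \<le> r \<Longrightarrow> m1 r = m r"
    using reaches_compile_exp[of P l 32 e m s w] Asg.prems by auto
  define m2 where "m2 = m1(32 := a + 64 * m1 32, Suc 32 := a)"
  have r2: "reaches P w 8 (l + ?n, m1) (l + ?n + 8, m2)"
    using Asg.prems unfolding m2_def by (intro reaches_address_of) simp
  have "represents m2 s"
    using m1(3) by (intro represents_cong[OF Asg.prems(2)]) (auto simp: m2_def)
  moreover have "code_at P (l + ?n + 8) (compile_exp 33 f)"
    using Asg.prems by (simp add: address_of_def ac_simps)
  \<comment> \<open>The value is computed one stack level higher, which protects the address waiting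
    in register 32.\<close>
  ultimately obtain m3 where m3: "reaches P w ?k (l + ?n + 8, m2) (l + ?n + 8 + ?k, m3)"
      "m3 33 = val w s f" "\<And>r. r < 33 \<or> 64 \<le> r \<Longrightarrow> m3 r = m2 r"
    using reaches_compile_exp[of P "l + ?n + 8" 33 f m2 s w] Asg.prems by auto
  have r4: "reaches P w 1 (l + ?n + 8 + ?k, m3) (l + ?n + 8 + ?k + 1, m3(m3 32 := m3 33))"
    using Asg.prems by (simp add: reaches_step address_of_def ac_simps)
  have "represents m3 s"
    using m1(3) m3(3) by (intro represents_cong[OF Asg.prems(2)]) (auto simp: m2_def)
  moreover have "m3 32 = a + 64 * val w s e"
    using m1(2) m3(3) by (simp add: m2_def)
  ultimately have "represents (m3(m3 32 := m3 33)) (den w (Asg a e f) s)"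
    using Asg.prems m3(2) by (simp add: represents_update)
  moreover have "reaches P w (?n + 8 + ?k + 1) (l, m)
      (l + ?n + 8 + ?k + 1, m3(m3 32 := m3 33))"
    using m1(1) r2 m3(1) r4 reaches_trans by blast
  moreover have "length (compile l (Asg a e f)) = ?n + 8 + ?k + 1"
    by (simp add: address_of_def)
  moreover have "?n + 8 + ?k + 1 \<le> poly (steps (Asg a e f)) (length w)"
    by (simp add: address_of_def)
  ultimately show ?case by (metis add.assoc)
next
  case (Seq c d)
  let ?n = "length (compile l c)"
  obtain n1 m1 where 1: "reaches P w n1 (l, m) (l + ?n, m1)" "n1 \<le> poly (steps c) (length w)"
      "represents m1 (den w c s)"
    using Seq.IH(1)[of l m s] Seq.prems by (auto simp: Let_def)
  then obtain n2 m2 where 2: "reaches P w n2 (l + ?n, m1) (l + ?n + length (compile (l + ?n) d), m2)"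
      "n2 \<le> poly (steps d) (length w)" "represents m2 (den w d (den w c s))"
    using Seq.IH(2)[of "l + ?n" m1 "den w c s"] Seq.prems by (auto simp: Let_def)
  show ?case
    using reaches_trans[OF 1(1) 2(1)] 1(2) 2(2,3)
    by (intro exI[of _ "n1 + n2"] exI[of _ m2]) (simp add: Let_def ac_simps)
next
  case (If e c d)
  let ?n = "length (compile_exp 32 e)"
  let ?lc = "l + ?n + 1"
  let ?C = "compile ?lc c"
  let ?ld = "l + ?n + length ?C + 2"
  let ?D = "compile ?ld d"
  obtain m1 where m1: "reaches P w ?n (l, m) (l + ?n, m1)" "m1 32 = val w s e"
      "\<And>r. r < 32 \<or> 64 \<le> r \<Longrightarrow> m1 r = m r"
    using reaches_compile_exp[of P l 32 e m s w] If.prems by (auto simp: Let_def)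
  have rep: "represents m1 s"
    using m1(3) by (intro represents_cong[OF If.prems(2)]) auto
  show ?case
  proof (cases "val w s e = 0")
    case True
    have "reaches P w 1 (l + ?n, m1) (?ld, m1)"
      using If.prems True m1(2) by (simp add: reaches_step Let_def)
    moreover obtain n2 m2 where 2: "reaches P w n2 (?ld, m1) (?ld + length ?D, m2)"
        "n2 \<le> poly (steps d) (length w)" "represents m2 (den w d s)"
      using If.IH(2)[of ?ld m1 s] If.prems rep by (auto simp: Let_def ac_simps)
    ultimately have "reaches P w (?n + 1 + n2) (l, m) (?ld + length ?D, m2)"
      using m1(1) reaches_trans by blast
    then show ?thesis
      using 2(2,3) True
      by (intro exI[of _ "?n + 1 + n2"] exI[of _ m2]) (simp add: Let_def ac_simps)
  next
    case False
    have "reaches P w 1 (l + ?n, m1) (?lc, m1)"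
      using If.prems False m1(2) by (simp add: reaches_step Let_def)
    moreover obtain n2 m2 where 2: "reaches P w n2 (?lc, m1) (?lc + length ?C, m2)"
        "n2 \<le> poly (steps c) (length w)" "represents m2 (den w c s)"
      using If.IH(1)[of ?lc m1 s] If.prems rep by (auto simp: Let_def)
    moreover have "reaches P w 1 (?lc + length ?C, m2) (?ld + length ?D, m2)"
      using If.prems by (simp add: reaches_step Let_def)
    ultimately have "reaches P w (?n + 1 + n2 + 1) (l, m) (?ld + length ?D, m2)"
      using m1(1) reaches_trans by blast
    then show ?thesis
      using 2(2,3) False
      by (intro exI[of _ "?n + 1 + n2 + 1"] exI[of _ m2]) (simp add: Let_def ac_simps)
  qed
next
  case (For x c)
  let ?C = "compile (l + 3) c"
  let ?e = "l + length ?C + 6"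
  let ?t = "poly (steps c) (length w)"
  define f where "f k = fold (\<lambda>i s. den w c (s((x, 0) := i))) [0..<k] s" for k
  have code: "code_at P l [Const x 0, Input 32 x, JumpZero 32 ?e]" "code_at P (l + 3) ?C"
      "code_at P (l + 3 + length ?C) [Const 32 1, Add x x 32, Jump (l + 1)]"
    using For.prems by (simp_all add: Let_def numeral_3_eq_3)
  have x: "x < 32" "x \<notin> assigned c" "ok c" using For.prems by auto
  \<comment> \<open>The claim concerns arrivals at the loop test \<open>l + 1\<close>. The machine
    has already incremented the counter there, while \<open>f k\<close> does not yet contain that
    update; hence the explicit assignment of \<open>k\<close>.\<close>
  have loop: "\<exists>n m'. reaches P w n (l, m) (l + 1, m') \<and> n \<le> 1 + k * (?t + 5) \<and>
      represents m' ((f k)((x, 0) := k))" if "k \<le> length w" for k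
    using that
  proof (induction k)
    case 0
    have "reaches P w 1 (l, m) (l + 1, m(x := 0))"
      using code by (simp add: reaches_step)
    moreover have "represents (m(x := 0)) ((f 0)((x, 0) := 0))"
      using represents_update[OF For.prems(2) x(1), of 0] by (simp add: f_def)
    moreover have "1 \<le> 1 + 0 * (?t + 5)" by simp
    ultimately show ?case by blast
  next
    case (Suc k)
    let ?s = "(f k)((x, 0) := k)"
    obtain n m1 where 1: "reaches P w n (l, m) (l + 1, m1)" "n \<le> 1 + k * (?t + 5)"
        "represents m1 ?s"
      using Suc.IH Suc.prems by (meson Suc_leD)
    have "m1 x = k"
      using represents_scalar[OF 1(3) x(1)] by simp
    moreover have "input_at w k \<noteq> 0" using Suc.prems by (simp add: input_at_eq_0_iff)
    ultimately have test: "reaches P w 2 (l + 1, m1) (l + 3, m1(32 := input_at w k))"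
      using code by (simp add: reaches_step numeral_2_eq_2 numeral_3_eq_3)
    have "represents (m1(32 := input_at w k)) ?s"
      by (rule represents_cong[OF 1(3)]) auto
    then obtain n2 m2 where 2: "reaches P w n2 (l + 3, m1(32 := input_at w k)) (l + 3 + length ?C, m2)"
        "n2 \<le> ?t" "represents m2 (den w c ?s)"
      using For.IH[of "l + 3" _ ?s] code x by blast
    let ?m = "m2(32 := 1, x := m2 x + 1)"
    have jump: "reaches P w 3 (l + 3 + length ?C, m2) (l + 1, ?m)"
      using code x(1) by (simp add: reaches_step numeral_3_eq_3)
    have "m2 x = k"
      using represents_scalar[OF 2(3) x(1)] den_unassigned[OF x(2)] by simp
    moreover have "represents (m2(32 := 1)) (den w c ?s)"
      by (rule represents_cong[OF 2(3)]) auto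
    ultimately have "represents ?m ((f (Suc k))((x, 0) := Suc k))"
      using represents_update[of _ _ x 0] x(1) by (fastforce simp: f_def)
    moreover have "reaches P w (n + 2 + n2 + 3) (l, m) (l + 1, ?m)"
      using 1(1) test 2(1) jump reaches_trans by blast
    moreover have "n + 2 + n2 + 3 \<le> 1 + Suc k * (?t + 5)"
      using 1(2) 2(2) by simp
    ultimately show ?case by blast
  qed
  obtain n m1 where 1: "reaches P w n (l, m) (l + 1, m1)" "n \<le> 1 + length w * (?t + 5)"
      "represents m1 ((f (length w))((x, 0) := length w))"
    using loop by blast
  let ?m = "m1(32 := 0)"
  have "m1 x = length w"
    using represents_scalar[OF 1(3) x(1)] by simp
  moreover have "input_at w (length w) = 0" by (simp add: input_at_eq_0_iff)
  ultimately have "reaches P w 2 (l + 1, m1) (?e, ?m)"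
    using code by (simp add: reaches_step numeral_2_eq_2)
  then have "reaches P w (n + 2) (l, m) (?e, ?m)"
    using 1(1) reaches_trans by blast
  moreover have "represents ?m (den w (For x c) s)"
    by (rule represents_cong[of m1]) (use 1(3) in \<open>auto simp: f_def\<close>)
  moreover have "l + length (compile l (For x c)) = ?e" by (simp add: Let_def)
  moreover have "n + 2 \<le> poly (steps (For x c)) (length w)" using 1(2) by simp
  ultimately show ?case by metis
qed

text \<open>The interface to the machine model: from here on only \<open>den\<close> matters. The
  time bound is quadratic in the number of steps.\<close>

lemma poly_time_solvable_if_den:
  assumes "ok c"
    and "\<And>I w. I \<in> D \<Longrightarrow> enc I w \<Longrightarrow> den w c (\<lambda>_. 0) (0, 0) \<noteq> 0 \<longleftrightarrow> Y I"
  shows "poly_time_solvable D Y enc"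
proof -
  let ?P = "compile 0 c"
  \<comment> \<open>Adding 2 ensures \<open>1 < K\<close>, as \<open>exec_if_halts\<close> demands,
    for every program.\<close>
  define K where "K = sum_list (map operand_sum ?P) + 2"
  let ?b = "steps c * ([:5:] * (steps c + [:K:]))"
  show ?thesis
    unfolding poly_time_solvable_def
  proof (intro exI[of _ ?P] exI[of _ ?b] ballI allI impI)
    fix I w
    assume "I \<in> D" "enc I w"
    obtain n m where 1: "reaches ?P w n (0, \<lambda>_. 0) (length ?P, m)"
        "n \<le> poly (steps c) (length w)" "represents m (den w c (\<lambda>_. 0))"
      using reaches_comp[of ?P 0 c "\<lambda>_. 0" "\<lambda>_. 0" w] assms(1)
      by (auto simp: code_at_def represents_def)
    have "operand_sum i \<le> K" if "i \<in> set ?P" for i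
      using member_le_sum_list[of "operand_sum i" "map operand_sum ?P"] that
      by (simp add: K_def)
    then obtain t where t: "exec ?P w (0, \<lambda>_. 0) t (length ?P, m)" "t \<le> n * (5 * (0 + n + K))"
      using exec_if_halts[of n ?P w 0 "\<lambda>_. 0" "length ?P" m 0 K] 1(1)
      by (auto simp: reaches_def K_def)
    have "n * (5 * (0 + n + K)) \<le> poly ?b (length w)"
      using mult_le_mono[OF 1(2), of "5 * (0 + n + K)" "5 * (poly (steps c) (length w) + K)"] 1(2)
      by (simp add: algebra_simps)
    then have "t \<le> poly ?b (length w)"
      using t(2) by linarith
    moreover have "m 0 \<noteq> 0 \<longleftrightarrow> Y I"
      using assms(2)[OF \<open>I \<in> D\<close> \<open>enc I w\<close>] represents_scalar[OF 1(3), of 0] by simp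
    ultimately show "\<exists>t pc m. exec ?P w (0, \<lambda>_. 0) t (pc, m) \<and> t \<le> poly ?b (length w) \<and>
        (m 0 \<noteq> 0 \<longleftrightarrow> Y I)"
      using t(1) by blast
  qed
qed

section \<open>Reading the input\<close>

abbreviation Var :: "nat \<Rightarrow> exp" where "Var x \<equiv> Arr x (N 0)"
abbreviation Assign :: "nat \<Rightarrow> exp \<Rightarrow> com" where "Assign x e \<equiv> Asg x (N 0) e"

abbreviation (input) "v_answer \<equiv> 0 :: nat"
abbreviation (input) "v_mode \<equiv> 1 :: nat"
abbreviation (input) "v_budget \<equiv> 2 :: nat"
abbreviation (input) "v_limit \<equiv> 3 :: nat"
abbreviation (input) "v_count \<equiv> 4 :: nat"
abbreviation (input) "v_target \<equiv> 5 :: nat"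
abbreviation (input) "v_column \<equiv> 6 :: nat"
abbreviation (input) "v_size \<equiv> 7 :: nat"
abbreviation (input) "v_standard \<equiv> 8 :: nat"
abbreviation (input) "v_cost \<equiv> 9 :: nat"
abbreviation (input) "v_weight \<equiv> 10 :: nat"
abbreviation (input) "v_score \<equiv> 11 :: nat"
abbreviation (input) "v_table \<equiv> 12 :: nat"
abbreviation (input) "v_a \<equiv> 13 :: nat"
abbreviation (input) "v_p \<equiv> 14 :: nat"
abbreviation (input) "v_b \<equiv> 15 :: nat"
abbreviation (input) "v_j \<equiv> 16 :: nat"
abbreviation (input) "v_new \<equiv> 17 :: nat"
abbreviation (input) "v_cand \<equiv> 18 :: nat"

text \<open>Modes \<open>0\<close> to \<open>6\<close>: reading the budget, the limit, the first bit of a project, its target bit, its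
  cost, its weight, the voters.\<close>

definition parse_body :: com where
  "parse_body = (let sym = In (Var v_a); sep = Minus sym (N 2); bit = Minus sym (N 1) in
     Seq (Assign v_size (Plus (Var v_size) (N 1)))
     (If (Minus (Var v_mode) (N 5))
       (If sep (Assign v_column (N 0))
         (Seq (Asg v_score (Var v_column) (Plus (Arr v_score (Var v_column)) bit))
           (Assign v_column (Plus (Var v_column) (N 1)))))
     (If (Minus (Var v_mode) (N 4))
       (If sep (Seq (Assign v_count (Plus (Var v_count) (N 1))) (Assign v_mode (N 2)))
         (Asg v_weight (Var v_count)
           (Plus (Plus (Arr v_weight (Var v_count)) (Arr v_weight (Var v_count))) bit)))
     (If (Minus (Var v_mode) (N 3))
       (If sep (Assign v_mode (N 5))
         (Asg v_cost (Var v_count) (Plus (Arr v_cost (Var v_count)) (N 1))))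
     (If (Minus (Var v_mode) (N 2))
       (Seq (If bit (Assign v_target (Var v_count)) Skip) (Assign v_mode (N 4)))
     (If (Minus (Var v_mode) (N 1))
       (If sep (Assign v_mode (N 6))
         (Seq (Asg v_standard (Var v_count) bit) (Assign v_mode (N 3))))
     (If (Var v_mode)
       (If sep (Assign v_mode (N 2))
         (Assign v_limit (Plus (Plus (Var v_limit) (Var v_limit)) bit)))
       (If sep (Assign v_mode (N 1))
         (Assign v_budget (Plus (Plus (Var v_budget) (Var v_budget)) bit))))))))))"

text \<open>The parser's variables without the rest of the store, so that reading the word becomes a
  fold over its symbols.\<close>

record parse_state =
  ps_mode :: nat
  ps_budget :: nat
  ps_limit :: nat
  ps_count :: nat
  ps_target :: nat
  ps_column :: nat
  ps_standard :: "nat \<Rightarrow> nat"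
  ps_cost :: "nat \<Rightarrow> nat"
  ps_weight :: "nat \<Rightarrow> nat"
  ps_score :: "nat \<Rightarrow> nat"

definition parse_view :: "store \<Rightarrow> parse_state" where
  "parse_view s = \<lparr>ps_mode = s (v_mode, 0), ps_budget = s (v_budget, 0), ps_limit = s (v_limit, 0),
     ps_count = s (v_count, 0), ps_target = s (v_target, 0), ps_column = s (v_column, 0),
     ps_standard = (\<lambda>i. s (v_standard, i)), ps_cost = (\<lambda>i. s (v_cost, i)),
     ps_weight = (\<lambda>i. s (v_weight, i)), ps_score = (\<lambda>i. s (v_score, i))\<rparr>"

text \<open>In mode 2 the next symbol decides: a bit opens another project, \<open>Sep\<close> ends
  the project list. \<open>Sep\<close> in mode 3 occurs in no encoding; its clause records what the
  program does, where 3 - 1 is nonzero and thus counts as a set target bit.\<close>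

fun parse_symbol :: "symbol \<Rightarrow> parse_state \<Rightarrow> parse_state" where
  "parse_symbol Sep s =
    (if ps_mode s = 0 then s\<lparr>ps_mode := 1\<rparr>
     else if ps_mode s = 1 then s\<lparr>ps_mode := 2\<rparr>
     else if ps_mode s = 2 then s\<lparr>ps_mode := 6\<rparr>
     else if ps_mode s = 3 then s\<lparr>ps_target := ps_count s, ps_mode := 4\<rparr>
     else if ps_mode s = 4 then s\<lparr>ps_mode := 5\<rparr>
     else if ps_mode s = 5 then s\<lparr>ps_count := Suc (ps_count s), ps_mode := 2\<rparr>
     else s\<lparr>ps_column := 0\<rparr>)"
| "parse_symbol (Bit b) s =
    (if ps_mode s = 0 then s\<lparr>ps_budget := 2 * ps_budget s + of_bool b\<rparr>
     else if ps_mode s = 1 then s\<lparr>ps_limit := 2 * ps_limit s + of_bool b\<rparr>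
     else if ps_mode s = 2 then
       s\<lparr>ps_standard := (ps_standard s)(ps_count s := of_bool b), ps_mode := 3\<rparr>
     else if ps_mode s = 3 then
       s\<lparr>ps_target := (if b then ps_count s else ps_target s), ps_mode := 4\<rparr>
     else if ps_mode s = 4 then
       s\<lparr>ps_cost := (ps_cost s)(ps_count s := Suc (ps_cost s (ps_count s)))\<rparr>
     else if ps_mode s = 5 then
       s\<lparr>ps_weight := (ps_weight s)
           (ps_count s := 2 * ps_weight s (ps_count s) + of_bool b)\<rparr>
     else s\<lparr>ps_score := (ps_score s)(ps_column s := ps_score s (ps_column s) + of_bool b),
            ps_column := Suc (ps_column s)\<rparr>)"

text \<open>Symbols are read as 1, 2 (bits) and 3 (\<open>Sep\<close>). Truncated subtraction of 2
  is therefore nonzero only for \<open>Sep\<close>, subtraction of 1 gives the value of a bit, and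
  the tests on the mode single it out from 6 downwards.\<close>

lemma parse_view_parse_body:
  assumes "i < length w" "s (v_a, 0) = i"
  shows "parse_view (den w parse_body s) = parse_symbol (w ! i) (parse_view s)"
proof (cases "w ! i")
  case Sep
  then have "input_at w i = 3" using assms by (simp add: input_at_def)
  then show ?thesis
    using Sep assms(2) by (auto simp: parse_body_def parse_view_def Let_def fun_eq_iff)
next
  case (Bit b)
  then have "input_at w i = Suc (of_bool b)" using assms by (simp add: input_at_def)
  then show ?thesis
    using Bit assms(2) by (cases b) (auto simp: parse_body_def parse_view_def Let_def fun_eq_iff)
qed

abbreviation "parse \<equiv> fold parse_symbol"

text \<open>Horner's scheme; \<open>bits\<close> starts with the most significant bit.\<close>

lemma fold_bits: "fold (\<lambda>b a. 2 * a + of_bool b) (bits n) 0 = n"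
proof (induction n rule: bits.induct)
  case (1 n)
  then show ?case by (subst bits.simps) (auto simp: odd_iff_mod_2_eq_one)
qed

lemma parse_budget_bits:
  "ps_mode s = 0 \<Longrightarrow>
    parse (map Bit bs) s = s\<lparr>ps_budget := fold (\<lambda>b a. 2 * a + of_bool b) bs (ps_budget s)\<rparr>"
  by (induction bs arbitrary: s) auto

lemma parse_limit_bits:
  "ps_mode s = 1 \<Longrightarrow>
    parse (map Bit bs) s = s\<lparr>ps_limit := fold (\<lambda>b a. 2 * a + of_bool b) bs (ps_limit s)\<rparr>"
  by (induction bs arbitrary: s) auto

lemma parse_cost_bits:
  "ps_mode s = 4 \<Longrightarrow>
    parse (replicate k (Bit True)) s =
      s\<lparr>ps_cost := (ps_cost s)(ps_count s := ps_cost s (ps_count s) + k)\<rparr>"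
  by (induction k arbitrary: s) (simp_all del: fold_replicate)

lemma parse_weight_bits:
  "ps_mode s = 5 \<Longrightarrow>
    parse (map Bit bs) s = s\<lparr>ps_weight := (ps_weight s)
      (ps_count s := fold (\<lambda>b a. 2 * a + of_bool b) bs (ps_weight s (ps_count s)))\<rparr>"
  by (induction bs arbitrary: s) auto

lemma parse_unary_cost:
  "ps_mode s = 4 \<Longrightarrow> parse (unary k) s =
    s\<lparr>ps_cost := (ps_cost s)(ps_count s := ps_cost s (ps_count s) + k), ps_mode := 5\<rparr>"
  by (simp add: unary_def parse_cost_bits del: fold_replicate)

lemma parse_binary_weight:
  "ps_mode s = 5 \<Longrightarrow> ps_weight s (ps_count s) = 0 \<Longrightarrow> parse (binary n) s =
    s\<lparr>ps_weight := (ps_weight s)(ps_count s := n), ps_count := Suc (ps_count s), ps_mode := 2\<rparr>"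
  by (simp add: binary_def parse_weight_bits fold_bits)

text \<open>Cost and weight are accumulated in place, so their cells at \<open>ps_count s\<close>
  have to start at 0.\<close>

lemma parse_encode_project:
  assumes "ps_mode s = 2" "ps_cost s (ps_count s) = 0" "ps_weight s (ps_count s) = 0"
  shows "parse (encode_project I q) s =
    s\<lparr>ps_standard := (ps_standard s)(ps_count s := of_bool (q \<in> projects I)),
      ps_target := (if q = target I then ps_count s else ps_target s),
      ps_cost := (ps_cost s)(ps_count s := cost I q),
      ps_weight := (ps_weight s)(ps_count s := weight I q),
      ps_count := Suc (ps_count s),
      ps_mode := 2\<rparr>"
proof -
  have "parse [Bit (q \<in> projects I), Bit (q = target I)] s =
    s\<lparr>ps_standard := (ps_standard s)(ps_count s := of_bool (q \<in> projects I)),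
      ps_target := (if q = target I then ps_count s else ps_target s), ps_mode := 4\<rparr>"
    using assms(1) by simp
  then show ?thesis
    unfolding encode_project_def fold_append comp_apply
    using assms(2,3) by (simp add: parse_unary_cost parse_binary_weight)
qed

text \<open>The claims are proved together because reading one more project relies on the mode, the
  count and the cells beyond the count still being 0.\<close>

lemma parse_encode_projects:
  fixes I :: "('p, 'v) control_input" and s :: parse_state
  assumes "ps_mode s = 2" "ps_count s = 0" "ps_cost s = (\<lambda>_. 0)" "ps_weight s = (\<lambda>_. 0)"
  defines "s' \<equiv> \<lambda>qs. parse (concat (map (encode_project I) qs)) s"
  shows "ps_mode (s' qs) = 2" "ps_count (s' qs) = length qs"
    "ps_standard (s' qs) i = (if i < length qs then of_bool (qs ! i \<in> projects I) else ps_standard s i)"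
    "ps_cost (s' qs) i = (if i < length qs then cost I (qs ! i) else 0)"
    "ps_weight (s' qs) i = (if i < length qs then weight I (qs ! i) else 0)"
    "target I \<in> set qs \<Longrightarrow> ps_target (s' qs) < length qs \<and> qs ! ps_target (s' qs) = target I"
    "ps_budget (s' qs) = ps_budget s" "ps_limit (s' qs) = ps_limit s"
    "ps_column (s' qs) = ps_column s" "ps_score (s' qs) = ps_score s"
proof (induction qs arbitrary: i rule: rev_induct)
  case Nil
  {
    case 1 then show ?case using assms(1) by (simp add: s'_def)
  next
    case 2 then show ?case using assms(2) by (simp add: s'_def)
  next
    case 3 then show ?case by (simp add: s'_def)
  next
    case 4 then show ?case using assms(3) by (simp add: s'_def)
  next
    case 5 then show ?case using assms(4) by (simp add: s'_def)
  next
    case 6 then show ?case by simp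
  next
    case 7 then show ?case by (simp add: s'_def)
  next
    case 8 then show ?case by (simp add: s'_def)
  next
    case 9 then show ?case by (simp add: s'_def)
  next
    case 10 then show ?case by (simp add: s'_def)
  }
next
  case (snoc q qs)
  have "s' (qs @ [q]) = parse (encode_project I q) (s' qs)"
    by (simp add: s'_def)
  also have "\<dots> = (s' qs)
    \<lparr>ps_standard := (ps_standard (s' qs))(length qs := of_bool (q \<in> projects I)),
      ps_target := (if q = target I then length qs else ps_target (s' qs)),
      ps_cost := (ps_cost (s' qs))(length qs := cost I q),
      ps_weight := (ps_weight (s' qs))(length qs := weight I q),
      ps_count := Suc (length qs), ps_mode := 2\<rparr>"
    using snoc by (simp add: parse_encode_project)
  finally have eq: "s' (qs @ [q]) = \<dots>" .
  {
    case 1 show ?case using snoc by (simp add: eq)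
  next
    case 2 show ?case using snoc by (simp add: eq)
  next
    case 3 show ?case using snoc by (simp add: eq nth_append)
  next
    case 4 show ?case using snoc by (simp add: eq nth_append)
  next
    case 5 show ?case using snoc by (simp add: eq nth_append)
  next
    case 6 then show ?case using snoc(6) by (auto simp add: eq nth_append)
  next
    case 7 show ?case using snoc by (simp add: eq)
  next
    case 8 show ?case using snoc by (simp add: eq)
  next
    case 9 show ?case using snoc by (simp add: eq)
  next
    case 10 show ?case using snoc by (simp add: eq)
  }
qed

lemma parse_score_bits:
  assumes "ps_mode s = 6" "ps_column s = 0"
  shows "parse (map Bit bs) s = s\<lparr>ps_column := length bs,
    ps_score := (\<lambda>j. ps_score s j + (if j < length bs then of_bool (bs ! j) else 0))\<rparr>"
  using assms
proof (induction bs rule: rev_induct)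
  case (snoc b bs)
  then show ?case by (auto simp: nth_append fun_eq_iff)
qed simp

lemma parse_encode_voters:
  assumes "ps_mode s = 6" "ps_column s = 0"
  shows "parse (concat (map (encode_voter I) vs)) s =
    s\<lparr>ps_column := 0, ps_score := (\<lambda>j. ps_score s j +
      (if j < length (tie I) then \<Sum>v\<leftarrow>vs. of_bool (tie I ! j \<in> approves I v) else 0))\<rparr>"
proof (induction vs rule: rev_induct)
  case (snoc v vs)
  let ?s = "parse (concat (map (encode_voter I) vs)) s"
  have "encode_voter I v = map Bit (map (\<lambda>q. q \<in> approves I v) (tie I)) @ [Sep]"
    by (simp add: encode_voter_def)
  then have "parse (encode_voter I v) ?s = ?s\<lparr>ps_column := 0, ps_score := (\<lambda>j. ps_score ?s j +
      (if j < length (tie I) then of_bool (tie I ! j \<in> approves I v) else 0))\<rparr>"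
    using snoc assms
      parse_score_bits[of ?s "map (\<lambda>q. q \<in> approves I v) (tie I)"]
    by (auto simp del: map_map cong: if_cong)
  then show ?case using snoc by (simp add: fun_eq_iff)
qed (auto intro!: parse_state.equality simp: assms)

definition approval_score :: "('p, 'v) control_input \<Rightarrow> 'p \<Rightarrow> nat" where
  "approval_score I q = card {v \<in> voters I. q \<in> approves I v}"

abbreviation "parse_init \<equiv> parse_view (\<lambda>_. 0)"

lemma parse_encodes:
  assumes "encodes I w" "target I \<in> set (tie I)"
  defines "s \<equiv> parse w parse_init"
  shows "ps_budget s = budget I" "ps_limit s = limit I" "ps_count s = length (tie I)"
    "ps_target s < length (tie I)" "tie I ! ps_target s = target I"
    "\<And>i. i < length (tie I) \<Longrightarrow> ps_standard s i = of_bool (tie I ! i \<in> projects I)"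
    "\<And>i. i < length (tie I) \<Longrightarrow> ps_cost s i = cost I (tie I ! i)"
    "\<And>i. i < length (tie I) \<Longrightarrow> ps_weight s i = weight I (tie I ! i)"
    "\<And>i. i < length (tie I) \<Longrightarrow> ps_score s i = approval_score I (tie I ! i)"
proof -
  obtain vs where vs: "distinct vs" "set vs = voters I"
    and w: "w = binary (budget I) @ binary (limit I) @
         concat (map (encode_project I) (tie I)) @ [Sep] @
         concat (map (encode_voter I) vs)"
    using assms(1) unfolding encodes_def by blast
  define s1 where "s1 = parse (binary (budget I) @ binary (limit I)) parse_init"
  define s2 where "s2 = parse (concat (map (encode_project I) (tie I))) s1"
  have s1: "s1 = parse_init\<lparr>ps_budget := budget I, ps_limit := limit I, ps_mode := 2\<rparr>"
    by (simp add: s1_def binary_def parse_budget_bits parse_limit_bits fold_bits parse_view_def)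
  have "ps_mode s1 = 2" "ps_count s1 = 0" "ps_cost s1 = (\<lambda>_. 0)" "ps_weight s1 = (\<lambda>_. 0)"
    "ps_column s1 = 0" "ps_score s1 = (\<lambda>_. 0)" "ps_budget s1 = budget I" "ps_limit s1 = limit I"
    by (simp_all add: s1 parse_view_def)
  note s2_props = parse_encode_projects[OF this(1-4), of I "tie I", folded s2_def, unfolded this]
  have "s = parse (concat (map (encode_voter I) vs)) (s2\<lparr>ps_mode := 6\<rparr>)"
    using s2_props(1) by (simp add: s_def w s1_def s2_def)
  then have s: "s = s2\<lparr>ps_mode := 6, ps_column := 0, ps_score := (\<lambda>j. 
      if j < length (tie I) then \<Sum>v\<leftarrow>vs. of_bool (tie I ! j \<in> approves I v) else 0)\<rparr>"
    using s2_props by (simp add: parse_encode_voters)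
  have score: "(\<Sum>v\<leftarrow>vs. of_bool (q \<in> approves I v)) = approval_score I q" for q
  proof -
    have "(\<Sum>v\<leftarrow>vs. of_bool (q \<in> approves I v)) = (\<Sum>v\<in>set vs. of_bool (q \<in> approves I v) :: nat)"
      using vs(1) by (simp add: sum_list_distinct_conv_sum_set)
    also have "\<dots> = card (set vs \<inter> {v. q \<in> approves I v})"
      by (simp add: sum_of_bool_eq)
    finally show ?thesis
      by (simp add: approval_score_def vs(2) Int_def)
  qed
  show "ps_budget s = budget I" "ps_limit s = limit I" "ps_count s = length (tie I)"
    "ps_target s < length (tie I)" "tie I ! ps_target s = target I"
    "\<And>i. i < length (tie I) \<Longrightarrow> ps_standard s i = of_bool (tie I ! i \<in> projects I)"
    "\<And>i. i < length (tie I) \<Longrightarrow> ps_cost s i = cost I (tie I ! i)"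
    "\<And>i. i < length (tie I) \<Longrightarrow> ps_weight s i = weight I (tie I ! i)"
    "\<And>i. i < length (tie I) \<Longrightarrow> ps_score s i = approval_score I (tie I ! i)"
    using s2_props assms(2) score by (simp_all add: s)
qed

text \<open>This is where the unary costs enter: each cost contributes its own value to the length
  of the word. The other bounds let the same loop range cover positions of projects and
  scores.\<close>

lemma encodes_length:
  assumes "encodes I w"
  shows "length (tie I) < length w" "(\<Sum>q\<leftarrow>tie I. cost I q) < length w"
    "approval_score I q < length w"
proof -
  obtain vs where vs: "distinct vs" "set vs = voters I"
    and w: "w = binary (budget I) @ binary (limit I) @
         concat (map (encode_project I) (tie I)) @ [Sep] @
         concat (map (encode_voter I) vs)"
    using assms unfolding encodes_def by blast
  have "length xs \<le> length (concat (map (encode_project I) xs))"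
    "(\<Sum>q\<leftarrow>xs. cost I q) \<le> length (concat (map (encode_project I) xs))" for xs
    by (induction xs) (auto simp: encode_project_def unary_def)
  from this[of "tie I"] show "length (tie I) < length w" "(\<Sum>q\<leftarrow>tie I. cost I q) < length w"
    by (simp_all add: w binary_def)
  have "length xs \<le> length (concat (map (encode_voter I) xs))" for xs
    by (induction xs) (auto simp: encode_voter_def)
  from this[of vs] have "length vs < length w" by (simp add: w binary_def)
  moreover have "approval_score I q \<le> length vs"
    unfolding approval_score_def vs(2)[symmetric]
    using card_mono[of "set vs" "{v \<in> set vs. q \<in> approves I v}"] vs(1)
    by (simp add: distinct_card)
  ultimately show "approval_score I q < length w" by simp
qed

text \<open>Besides the parsed input, the control phase relies on the answer and the table still
  being 0. The length is kept in \<open>v_size\<close> because \<open>v_a\<close> becomes a counter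
  again.\<close>

lemma den_parse:
  fixes s0 :: store and w :: "symbol list"
  defines "s0 \<equiv> (\<lambda>_. 0)"
  defines "s \<equiv> den w (For v_a parse_body) s0"
  shows "parse_view s = parse w parse_init" "s (v_size, 0) = length w"
    "s (v_answer, i) = 0" "s (v_table, i) = 0"
proof -
  have "parse_view s = parse (take (length w) w) parse_init \<and> s (v_size, 0) = length w"
    unfolding s_def
  proof (rule For_induct[where R = "\<lambda>i s. parse_view s = parse (take i w) parse_init \<and> s (v_size, 0) = i"])
    show "parse_view s0 = parse (take 0 w) parse_init \<and> s0 (v_size, 0) = 0"
      by (simp add: s0_def)
  next
    fix i s
    assume i: "i < length w" "parse_view s = parse (take i w) parse_init \<and> s (v_size, 0) = i"
    have "parse_view (s((v_a, 0) := i)) = parse_view s"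
      by (simp add: parse_view_def)
    then show "parse_view (den w parse_body (s((v_a, 0) := i))) = parse (take (Suc i) w) parse_init \<and>
      den w parse_body (s((v_a, 0) := i)) (v_size, 0) = Suc i"
      using i by (simp add: parse_view_parse_body take_Suc_conv_app_nth)
        (simp add: parse_body_def Let_def)
  qed (simp add: parse_view_def)
  then show "parse_view s = parse w parse_init" "s (v_size, 0) = length w" by simp_all
  have "v_answer \<notin> assigned (For v_a parse_body)" "v_table \<notin> assigned (For v_a parse_body)"
    by (simp_all add: parse_body_def Let_def)
  then show "s (v_answer, i) = 0" "s (v_table, i) = 0"
    using den_unassigned[of _ "For v_a parse_body" w s0 i] by (simp_all only: s_def s0_def)
qed

section \<open>GreedyAV with added spoilers\<close>

definition project_order :: "('p, 'v) control_input \<Rightarrow> 'p list" where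
  "project_order I = sort_key (\<lambda>p. - int (approval_score I p)) (tie I)"

text \<open>\<open>greedy_step\<close> reads only costs and budget, which are the same for every S;
  the run is therefore taken in \<open>with_spoilers I {}\<close>.\<close>

definition outcome :: "('p, 'v) control_input \<Rightarrow> 'p list \<Rightarrow> 'p set" where
  "outcome I xs = fold (greedy_step (with_spoilers I {})) xs {}"

definition present :: "('p, 'v) control_input \<Rightarrow> 'p set \<Rightarrow> 'p list \<Rightarrow> 'p list" where
  "present I S xs = filter (\<lambda>p. p \<in> projects I \<union> S) xs"

definition spent :: "('p, 'v) control_input \<Rightarrow> 'p list \<Rightarrow> nat" where
  "spent I xs = sum (cost I) (outcome I xs)"

lemma sort_key_cong_set:
  assumes "\<And>x. x \<in> set xs \<Longrightarrow> f x = g x"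
  shows "sort_key f xs = sort_key g xs"
proof -
  have ins: "insort_key f x ys = insort_key g x ys" if "\<forall>y\<in>insert x (set ys). f y = g y" for x ys
    using that by (induction ys) auto
  show ?thesis using assms
    by (induction xs) (auto intro!: ins)
qed

text \<open>Stable sorting commutes with filtering, and restricting the approval sets does not
  change the score of a present project.\<close>

lemma greedy_av_with_spoilers:
  "greedy_av (tie I) (with_spoilers I S) = outcome I (present I S (project_order I))"
proof -
  have "greedy_step (with_spoilers I S) = greedy_step (with_spoilers I {})"
    by (auto simp: fun_eq_iff greedy_step_def with_spoilers_def)
  moreover have score: "score_av (with_spoilers I S) p = approval_score I p"
    if "p \<in> projects I \<union> S" for p
    using that by (simp add: score_av_def approval_score_def with_spoilers_def)
  have "projects (with_spoilers I S) = projects I \<union> S"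
    by (simp add: with_spoilers_def)
  then have "processing_order (tie I) (with_spoilers I S) = present I S (project_order I)"
    unfolding processing_order_def present_def project_order_def filter_sort
    by (simp only:) (rule sort_key_cong_set, simp add: score)
  ultimately show ?thesis
    by (simp add: greedy_av_def outcome_def)
qed

lemma outcome_Nil [simp]: "outcome I [] = {}"
  by (simp add: outcome_def)

lemma outcome_snoc:
  "outcome I (xs @ [q]) =
    (if spent I xs + cost I q \<le> budget I then insert q (outcome I xs) else outcome I xs)"
  by (simp add: outcome_def spent_def greedy_step_def with_spoilers_def)

lemma outcome_subset: "outcome I xs \<subseteq> set xs"
  by (induction xs rule: rev_induct) (auto simp: outcome_snoc)

lemma finite_outcome [simp]: "finite (outcome I xs)"
  by (rule finite_subset[OF outcome_subset]) simp

lemma spent_Nil [simp]: "spent I [] = 0"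
  by (simp add: spent_def)

lemma spent_snoc:
  assumes "q \<notin> set xs"
  shows "spent I (xs @ [q]) =
    (if spent I xs + cost I q \<le> budget I then spent I xs + cost I q else spent I xs)"
proof -
  have "q \<notin> outcome I xs" using assms outcome_subset[of I xs] by auto
  then have "sum (cost I) (insert q (outcome I xs)) = spent I xs + cost I q"
    by (simp add: spent_def)
  then show ?thesis
    by (simp add: spent_def[of I "xs @ [q]"] outcome_snoc) (simp add: spent_def)
qed

lemma spent_le: "spent I xs \<le> sum_list (map (cost I) xs)"
proof (induction xs rule: rev_induct)
  case (snoc q xs)
  have "sum (cost I) (insert q (outcome I xs)) \<le> cost I q + spent I xs"
    by (simp add: spent_def sum.insert_if)
  then show ?case using snoc by (simp add: spent_def[of I "xs @ [q]"] outcome_snoc) (simp add: spent_def)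
qed simp

lemma present_snoc:
  "present I S (xs @ [q]) = present I S xs @ (if q \<in> projects I \<union> S then [q] else [])"
  by (simp add: present_def)

lemma set_present: "set (present I S xs) = set xs \<inter> (projects I \<union> S)"
  by (auto simp: present_def)

lemma present_insert: "q \<notin> set xs \<Longrightarrow> present I (insert q S) xs = present I S xs"
  by (auto simp: present_def intro!: filter_cong)

section \<open>Attainable amounts and their least weights\<close>

text \<open>The weight is bounded rather than exact: this makes the predicate upward closed in
  \<open>v\<close>, so one threshold per amount describes it completely.\<close>

definition attainable :: "('p, 'v) control_input \<Rightarrow> 'p list \<Rightarrow> nat \<Rightarrow> nat \<Rightarrow> bool" where
  "attainable I xs j v \<longleftrightarrow> (\<exists>S \<subseteq> spoilers I \<inter> set xs. sum (weight I) S \<le> v \<and>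
     spent I (present I S xs) = j)"

lemma attainable_Nil: "attainable I [] j v \<longleftrightarrow> j = 0"
  by (auto simp: attainable_def present_def)

lemma attainable_mono: "attainable I xs j v \<Longrightarrow> v \<le> v' \<Longrightarrow> attainable I xs j v'"
  unfolding attainable_def using le_trans by blast

lemma attainable_le: "attainable I xs j v \<Longrightarrow> j \<le> sum_list (map (cost I) xs)"
  using spent_le[of I] sum_list_filter_le_nat[of "cost I" _ xs] le_trans
  unfolding attainable_def present_def by blast

lemma attainable_snoc_standard:
  assumes "q \<in> projects I" "q \<notin> spoilers I" "q \<notin> set xs"
  shows "attainable I (xs @ [q]) j v \<longleftrightarrow>
    attainable I xs j v \<and> budget I < j + cost I q \<or>
    cost I q \<le> j \<and> j \<le> budget I \<and> attainable I xs (j - cost I q) v"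
proof -
  have sub: "spoilers I \<inter> set (xs @ [q]) = spoilers I \<inter> set xs" using assms by auto
  have "spent I (present I S (xs @ [q])) = j \<longleftrightarrow>
     spent I (present I S xs) = j \<and> budget I < j + cost I q \<or>
     cost I q \<le> j \<and> j \<le> budget I \<and> spent I (present I S xs) = j - cost I q" for S
    using assms by (auto simp add: present_snoc spent_snoc set_present)
  then show ?thesis unfolding attainable_def sub by blast
qed

text \<open>Unlike for a standard project, the first alternative has no budget condition, since a
  spoiler may be left out. It also absorbs the case of an added but skipped spoiler, via
  \<open>attainable_mono\<close>.\<close>

lemma attainable_snoc_spoiler:
  assumes "q \<notin> projects I" "q \<in> spoilers I" "q \<notin> set xs"
  shows "attainable I (xs @ [q]) j v \<longleftrightarrow>
    attainable I xs j v \<or>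
    cost I q \<le> j \<and> j \<le> budget I \<and> weight I q \<le> v \<and> attainable I xs (j - cost I q) (v - weight I q)"
    (is "?l \<longleftrightarrow> ?r")
proof
  assume ?l
  then obtain S where S: "S \<subseteq> spoilers I \<inter> set (xs @ [q])" "sum (weight I) S \<le> v"
    "spent I (present I S (xs @ [q])) = j" unfolding attainable_def by blast
  have fin: "finite S" using S(1) finite_subset by blast
  show ?r
  proof (cases "q \<in> S")
    case False
    then have "present I S (xs @ [q]) = present I S xs" using assms by (simp add: present_snoc)
    moreover have "S \<subseteq> spoilers I \<inter> set xs" using S(1) False by auto
    ultimately have "attainable I xs j v" using S(2,3) unfolding attainable_def by metis
    then show ?thesis ..
  next
    case True
    define S' where "S' = S - {q}"
    have S': "S = insert q S'" "q \<notin> S'" "S' \<subseteq> spoilers I \<inter> set xs" "finite S'"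
      using True S(1) fin by (auto simp: S'_def)
    have w: "weight I q + sum (weight I) S' \<le> v" using S(2) S' by simp
    have "present I S (xs @ [q]) = present I S' xs @ [q]"
      using assms(3) by (simp add: present_snoc S'(1) present_insert)
    moreover have "q \<notin> set (present I S' xs)" using assms(3) by (simp add: set_present)
    ultimately have j: "j = (if spent I (present I S' xs) + cost I q \<le> budget I
        then spent I (present I S' xs) + cost I q else spent I (present I S' xs))"
      using S(3) by (simp add: spent_snoc)
    have att: "attainable I xs (spent I (present I S' xs)) (v - weight I q)"
      unfolding attainable_def using S'(3) w by (intro exI[of _ S']) auto
    show ?thesis
    proof (cases "spent I (present I S' xs) + cost I q \<le> budget I")
      case True
      then show ?thesis using j att w by auto
    next
      case False
      then show ?thesis using j att attainable_mono by fastforce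
    qed
  qed
next
  assume ?r
  then show ?l
  proof (elim disjE conjE)
    assume "attainable I xs j v"
    then obtain S where S: "S \<subseteq> spoilers I \<inter> set xs" "sum (weight I) S \<le> v"
      "spent I (present I S xs) = j" unfolding attainable_def by blast
    moreover have "present I S (xs @ [q]) = present I S xs"
      using S(1) assms by (auto simp add: present_snoc)
    ultimately show ?l unfolding attainable_def by (intro exI[of _ S]) auto
  next
    assume c: "cost I q \<le> j" "j \<le> budget I" "weight I q \<le> v"
      and "attainable I xs (j - cost I q) (v - weight I q)"
    then obtain S where S: "S \<subseteq> spoilers I \<inter> set xs" "sum (weight I) S \<le> v - weight I q"
      "spent I (present I S xs) = j - cost I q" unfolding attainable_def by blast
    have "q \<notin> S" using S(1) assms(3) by blast
    moreover have "finite S" using S(1) finite_subset by blast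
    ultimately have "sum (weight I) (insert q S) \<le> v" using S(2) c(3) by simp
    moreover have "present I (insert q S) (xs @ [q]) = present I S xs @ [q]"
      using assms(3) by (simp add: present_snoc present_insert)
    then have "spent I (present I (insert q S) (xs @ [q])) = j"
      using S(3) c assms(3) by (simp add: spent_snoc set_present)
    ultimately show ?l
      unfolding attainable_def using S(1) assms(2) by (intro exI[of _ "insert q S"]) auto
  qed
qed

text \<open>A table entry \<open>0\<close> means that the amount is not attainable; otherwise the entry is the least
  weight plus one.\<close>

definition table_for :: "('p, 'v) control_input \<Rightarrow> 'p list \<Rightarrow> (nat \<Rightarrow> nat) \<Rightarrow> bool" where
  "table_for I xs d \<longleftrightarrow> (\<forall>j v. 0 < d j \<and> d j \<le> Suc v \<longleftrightarrow> attainable I xs j v)"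

text \<open>A standard project that fits cannot be declined, so \<open>stay\<close> is then void. In
  \<open>cand\<close> the weight is added as it is, the offset by one being already part of the old
  entry. The last line is a minimum in which 0 plays the role of infinity.\<close>

definition relax :: "bool \<Rightarrow> nat \<Rightarrow> nat \<Rightarrow> nat \<Rightarrow> (nat \<Rightarrow> nat) \<Rightarrow> nat \<Rightarrow> nat" where
  "relax std c u B d j =
    (let stay = if std \<and> j + c \<le> B then 0 else d j;
         cand = if c \<le> j \<and> j \<le> B \<and> d (j - c) \<noteq> 0 then d (j - c) + (if std then 0 else u) else 0
     in if cand = 0 \<or> stay \<noteq> 0 \<and> stay \<le> cand then stay else cand)"

lemma table_for_Nil: "table_for I [] ((\<lambda>_. 0)(0 := 1))"
  by (simp add: table_for_def attainable_Nil)

text \<open>Lets the program leave cells beyond the total cost untouched.\<close>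

lemma table_for_eq_0:
  assumes "table_for I xs d" "sum_list (map (cost I) xs) < j"
  shows "d j = 0"
proof (rule ccontr)
  assume "d j \<noteq> 0"
  then have "0 < d j \<and> d j \<le> Suc (d j)" by simp
  then have "attainable I xs j (d j)" using assms(1) unfolding table_for_def by blast
  then show False using attainable_le assms(2) by fastforce
qed

lemma table_for_relax:
  assumes "table_for I xs d" "q \<notin> set xs" "q \<in> projects I \<union> spoilers I"
    "projects I \<inter> spoilers I = {}"
  shows "table_for I (xs @ [q]) (relax (q \<in> projects I) (cost I q) (weight I q) (budget I) d)"
  unfolding table_for_def
proof (intro allI)
  fix j v
  \<comment> \<open>A minimum with 0 as infinity is within a bound iff one of its arguments is; this
    matches the disjunctions in the two recurrences for \<open>attainable\<close>.\<close>
  have min: "0 < (if b = 0 \<or> a \<noteq> 0 \<and> a \<le> b then a else b) \<and>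
     (if b = 0 \<or> a \<noteq> 0 \<and> a \<le> b then a else b) \<le> Suc v \<longleftrightarrow>
     0 < a \<and> a \<le> Suc v \<or> 0 < b \<and> b \<le> Suc v" for a b :: nat
    by auto
  have d: "attainable I xs j v \<longleftrightarrow> 0 < d j \<and> d j \<le> Suc v" for j v
    using assms(1) by (auto simp: table_for_def)
  show "0 < relax (q \<in> projects I) (cost I q) (weight I q) (budget I) d j \<and>
     relax (q \<in> projects I) (cost I q) (weight I q) (budget I) d j \<le> Suc v \<longleftrightarrow>
     attainable I (xs @ [q]) j v"
  proof (cases "q \<in> projects I")
    case True
    then have q: "q \<notin> spoilers I" using assms(4) by auto
    show ?thesis
      unfolding attainable_snoc_standard[OF True q assms(2)] relax_def Let_def min d
      using True by auto
  next
    case False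
    then have q: "q \<in> spoilers I" using assms(3) by auto
    show ?thesis
      unfolding attainable_snoc_spoiler[OF False q assms(2)] relax_def Let_def min d
      using False by auto
  qed
qed

section \<open>Control decided on prefixes of the processing order\<close>

text \<open>\<open>fund\<close> selects constructive or destructive control, so both problems share
  one proof and one program scheme.\<close>

definition controllable :: "('p, 'v) control_input \<Rightarrow> bool \<Rightarrow> 'p list \<Rightarrow> bool" where
  "controllable I fund xs \<longleftrightarrow> (\<exists>S \<subseteq> spoilers I \<inter> set xs. sum (weight I) S \<le> limit I \<and>
     (target I \<in> outcome I (present I S xs) \<longleftrightarrow> fund))"

text \<open>The last project processed decides only about itself. If it is a spoiler, removing it
  from S keeps the fate of the target and does not increase the weight.\<close>

lemma controllable_snoc_other:
  assumes "q \<noteq> target I" "q \<notin> set xs"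
  shows "controllable I fund (xs @ [q]) \<longleftrightarrow> controllable I fund xs"
proof -
  have target: "target I \<in> outcome I (present I S (xs @ [q])) \<longleftrightarrow>
      target I \<in> outcome I (present I (S - {q}) xs)" for S
  proof -
    have "present I (S - {q}) xs = present I S xs"
      using assms(2) by (auto simp: present_def intro!: filter_cong)
    then show ?thesis using assms(1) by (simp add: present_snoc outcome_snoc)
  qed
  show ?thesis
  proof
    assume "controllable I fund (xs @ [q])"
    then obtain S where S: "S \<subseteq> spoilers I \<inter> set (xs @ [q])" "sum (weight I) S \<le> limit I"
      "target I \<in> outcome I (present I S (xs @ [q])) \<longleftrightarrow> fund"
      unfolding controllable_def by blast
    have "finite S" using S(1) finite_subset by blast
    then have "sum (weight I) (S - {q}) \<le> sum (weight I) S"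
      by (intro sum_mono2) auto
    then show "controllable I fund xs"
      unfolding controllable_def using S target by (intro exI[of _ "S - {q}"]) auto
  next
    assume "controllable I fund xs"
    then obtain S where S: "S \<subseteq> spoilers I \<inter> set xs" "sum (weight I) S \<le> limit I"
      "target I \<in> outcome I (present I S xs) \<longleftrightarrow> fund"
      unfolding controllable_def by blast
    moreover have "S - {q} = S" using S(1) assms(2) by blast
    ultimately show "controllable I fund (xs @ [q])"
      unfolding controllable_def using target[of S] by (intro exI[of _ S]) auto
  qed
qed

lemma controllable_snoc_target:
  assumes "target I \<notin> set xs" "target I \<in> projects I" "target I \<notin> spoilers I"
  shows "controllable I fund (xs @ [target I]) \<longleftrightarrow>
    (\<exists>j. attainable I xs j (limit I) \<and> (j + cost I (target I) \<le> budget I \<longleftrightarrow> fund))"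
proof -
  have "spoilers I \<inter> set (xs @ [target I]) = spoilers I \<inter> set xs" using assms by auto
  moreover have "target I \<in> outcome I (present I S (xs @ [target I])) \<longleftrightarrow>
      spent I (present I S xs) + cost I (target I) \<le> budget I" for S
    using assms(1,2) outcome_subset[of I "present I S xs"]
    by (auto simp: present_snoc outcome_snoc set_present)
  ultimately show ?thesis unfolding controllable_def attainable_def by auto
qed

lemma controllable_project_order:
  assumes "wf_control I"
  shows "cc_ac greedy_av I \<longleftrightarrow> controllable I True (project_order I)"
    "dc_ac greedy_av I \<longleftrightarrow> controllable I False (project_order I)"
proof -
  have "spoilers I \<inter> set (project_order I) = spoilers I"
    using assms by (auto simp: project_order_def wf_control_def)
  then show "cc_ac greedy_av I \<longleftrightarrow> controllable I True (project_order I)"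
    "dc_ac greedy_av I \<longleftrightarrow> controllable I False (project_order I)"
    by (simp_all add: cc_ac_def dc_ac_def controllable_def greedy_av_with_spoilers)
qed

section \<open>Stable sorting by buckets\<close>

text \<open>Round \<open>a\<close> collects the entries of key \<open>m - 1 - a\<close>, so keys decrease.\<close>

definition bucket_order :: "nat \<Rightarrow> nat \<Rightarrow> (nat \<Rightarrow> nat) \<Rightarrow> nat list" where
  "bucket_order m n f = concat (map (\<lambda>a. filter (\<lambda>p. f p + a + 1 = m) [0..<n]) [0..<m])"

text \<open>Key \<open>k\<close> is collected in round \<open>m - 1 - k\<close> only, and in the
  order of \<open>xs\<close>: this is the stability of bucket sort.\<close>

lemma filter_bucket:
  assumes "k < (m::nat)"
  shows "filter (\<lambda>x. f x = k) (concat (map (\<lambda>a. filter (\<lambda>p. f p + a + 1 = m) xs) [0..<l])) =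
    (if m - k \<le> l then filter (\<lambda>x. f x = k) xs else [])"
proof (induction l)
  case (Suc l)
  have "filter (\<lambda>x. f x = k) (filter (\<lambda>p. f p + l + 1 = m) xs) =
     (if m - k = Suc l then filter (\<lambda>x. f x = k) xs else [])"
    using assms by (auto simp: filter_empty_conv intro!: filter_cong)
  then show ?case using Suc by auto
qed (use assms in simp)

lemma mset_bucket:
  "mset (concat (map (\<lambda>a. filter (\<lambda>p. f p + a + 1 = m) xs) [0..<l])) =
    mset (filter (\<lambda>p. f p < m \<and> m \<le> f p + l) xs)"
proof (induction l)
  case (Suc l)
  have "mset (filter (\<lambda>p. f p < m \<and> m \<le> f p + l) xs) + mset (filter (\<lambda>p. f p + l + 1 = m) xs) =
    mset (filter (\<lambda>p. f p < m \<and> m \<le> f p + Suc l) xs)"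
    by (induction xs) auto
  then show ?case using Suc by simp
qed (auto simp: filter_empty_conv)

text \<open>A stable sort is determined by three properties: same multiset, sorted keys, and
  unchanged order within each key.\<close>

lemma sort_key_bucket:
  fixes f :: "'a \<Rightarrow> nat"
  assumes "\<And>x. x \<in> set xs \<Longrightarrow> f x < m"
  shows "sort_key (\<lambda>x. - int (f x)) xs =
    concat (map (\<lambda>a. filter (\<lambda>p. f p + a + 1 = m) xs) [0..<m])" (is "_ = ?ys")
proof (rule properties_for_sort_key)
  have "filter (\<lambda>p. f p < m \<and> m \<le> f p + m) xs = xs"
    using assms by (simp add: filter_id_conv)
  then show mset: "mset ?ys = mset xs" by (simp only: mset_bucket)
  show "filter (\<lambda>x. - int (f k) = - int (f x)) ?ys = filter (\<lambda>x. - int (f k) = - int (f x)) xs"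
    if "k \<in> set ?ys" for k
  proof -
    have "f k < m" using that by auto
    moreover have "(\<lambda>x. - int (f k) = - int (f x)) = (\<lambda>x. f x = f k)" by auto
    ultimately show ?thesis using filter_bucket[of "f k" m f xs m] by (simp only:) simp
  qed
  have const: "sorted (map g zs)" if "\<forall>z\<in>set zs. g z = c" for g :: "'a \<Rightarrow> int" and zs c
    using that by (induction zs) auto
  have "sorted (map (\<lambda>x. - int (f x))
      (concat (map (\<lambda>a. filter (\<lambda>p. f p + a + 1 = m) xs) [0..<l])))" for l
  proof (induction l)
    case (Suc l)
    have "sorted (map (\<lambda>x. - int (f x)) (filter (\<lambda>p. f p + l + 1 = m) xs))"
      by (rule const[where c = "int l + 1 - int m"]) auto
    then show ?case using Suc by (auto simp: sorted_append)
  qed simp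
  then show "sorted (map (\<lambda>x. - int (f x)) ?ys)" .
qed

text \<open>The program knows projects only by their positions in the tie-breaking list, so the
  sorting is transferred to positions.\<close>

lemma project_order_bucket:
  assumes "\<And>p. p \<in> set (tie I) \<Longrightarrow> approval_score I p < m"
  shows "project_order I =
    map ((!) (tie I)) (bucket_order m (length (tie I)) (\<lambda>i. approval_score I (tie I ! i)))"
proof -
  have "filter P (tie I) = map ((!) (tie I)) (filter (\<lambda>i. P (tie I ! i)) [0..<length (tie I)])" for P
    using filter_map[of P "(!) (tie I)" "[0..<length (tie I)]"] by (simp add: map_nth comp_def)
  then show ?thesis
    unfolding project_order_def bucket_order_def
    by (subst sort_key_bucket[OF assms]) (simp_all add: map_concat comp_def)
qed

section \<open>The control program\<close>

abbreviation (input) "cost_p \<equiv> Arr v_cost (Var v_p)"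

text \<open>Computes \<open>stay\<close> of \<open>relax\<close> in \<open>v_new\<close>. The inner
  subtraction is nonzero iff the project does not fit.\<close>

definition keep_entry :: com where
  "keep_entry =
     Seq (Assign v_new (Arr v_table (Var v_j)))
     (If (Arr v_standard (Var v_p))
        (If (Minus (Plus (Var v_j) cost_p) (Var v_budget)) Skip (Assign v_new (N 0)))
        Skip)"

text \<open>Computes \<open>cand\<close> of \<open>relax\<close> and merges it into
  \<open>v_new\<close>. The outermost test is c <= j in the form \<open>Suc j - c\<close> nonzero,
  which makes the later subtraction j - c exact.\<close>

definition extend_entry :: com where
  "extend_entry =
     If (Minus (Plus (Var v_j) (N 1)) cost_p)
       (If (Minus (Var v_j) (Var v_budget)) Skip
         (If (Arr v_table (Minus (Var v_j) cost_p))
           (Seq (Assign v_cand (Arr v_table (Minus (Var v_j) cost_p)))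
           (Seq (If (Arr v_standard (Var v_p)) Skip
              (Assign v_cand (Plus (Var v_cand) (Arr v_weight (Var v_p)))))
            (If (Var v_new)
              (If (Minus (Var v_new) (Var v_cand)) (Assign v_new (Var v_cand)) Skip)
              (Assign v_new (Var v_cand)))))
           Skip))
       Skip"

text \<open>The cells are updated by decreasing \<open>j\<close>, so that entry \<open>j - c\<close> is still the old one.\<close>

definition update_cell :: com where
  "update_cell =
     Seq (Assign v_j (Minus (Var v_size) (Plus (Var v_b) (N 1))))
     (Seq keep_entry (Seq extend_entry (Asg v_table (Var v_j) (Var v_new))))"

text \<open>The entry is compared with the limit plus one because entries are weights plus
  one.\<close>

definition inspect_cell :: "bool \<Rightarrow> com" where
  "inspect_cell fund =
     (let yes = Assign v_answer (N 1) in
      If (Arr v_table (Var v_b))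
       (If (Minus (Arr v_table (Var v_b)) (Plus (Var v_limit) (N 1))) Skip
         (If (Minus (Plus (Var v_b) cost_p) (Var v_budget))
           (if fund then Skip else yes) (if fund then yes else Skip)))
       Skip)"

abbreviation (input) if_equal :: "exp \<Rightarrow> exp \<Rightarrow> com \<Rightarrow> com" where
  "if_equal e f c \<equiv> If (Minus e f) Skip (If (Minus f e) Skip c)"

text \<open>Inspection comes before the update: the target's fate depends on the amounts spent on
  earlier projects.\<close>

definition process :: "bool \<Rightarrow> com" where
  "process fund =
     Seq (if_equal (Var v_p) (Var v_target) (For v_b (inspect_cell fund))) (For v_b update_cell)"

text \<open>The equality test selects the bucket of round \<open>v_a\<close> with
  \<open>m = length w\<close>; the outer guard discards input positions that are not positions of
  projects.\<close>

definition visit :: "bool \<Rightarrow> com" where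
  "visit fund = If (Minus (Var v_count) (Var v_p))
     (if_equal (Plus (Plus (Arr v_score (Var v_p)) (Var v_a)) (N 1)) (Var v_size) (process fund))
     Skip"

text \<open>The initial entry 1 at amount 0 stands for weight 0, reached by adding nothing.\<close>

definition control_program :: "bool \<Rightarrow> com" where
  "control_program fund =
     Seq (For v_a parse_body)
     (Seq (Asg v_table (N 0) (N 1))
     (For v_a (For v_p (visit fund))))"

lemmas program_defs = update_cell_def keep_entry_def extend_entry_def inspect_cell_def process_def visit_def control_program_def
  parse_body_def Let_def

lemma ok_control_program: "ok (control_program fund)"
  by (simp add: program_defs)

section \<open>Effect of the table operations\<close>

definition relax_p :: "store \<Rightarrow> nat \<Rightarrow> nat" where
  "relax_p s = relax (s (v_standard, s (v_p, 0)) \<noteq> 0) (s (v_cost, s (v_p, 0)))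
     (s (v_weight, s (v_p, 0))) (s (v_budget, 0)) (\<lambda>j. s (v_table, j))"

lemma den_keep_entry:
  "den w keep_entry s = s((v_new, 0) :=
    (if s (v_standard, s (v_p, 0)) \<noteq> 0 \<and> s (v_j, 0) + s (v_cost, s (v_p, 0)) \<le> s (v_budget, 0)
     then 0 else s (v_table, s (v_j, 0))))"
  by (simp add: keep_entry_def)

lemma den_extend_entry:
  "den w extend_entry s (v_new, 0) =
    (let std = s (v_standard, s (v_p, 0)) \<noteq> 0; c = s (v_cost, s (v_p, 0)); j = s (v_j, 0);
         cand = (if c \<le> j \<and> j \<le> s (v_budget, 0) \<and> s (v_table, j - c) \<noteq> 0
           then s (v_table, j - c) + (if std then 0 else s (v_weight, s (v_p, 0))) else 0)
     in if cand = 0 \<or> s (v_new, 0) \<noteq> 0 \<and> s (v_new, 0) \<le> cand then s (v_new, 0) else cand)"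
proof (cases "s (v_cost, s (v_p, 0)) \<le> s (v_j, 0) \<and> s (v_j, 0) \<le> s (v_budget, 0)")
  case True
  then show ?thesis
    by (cases "s (v_table, s (v_j, 0) - s (v_cost, s (v_p, 0)))")
      (simp_all add: extend_entry_def Let_def)
next
  case False
  then show ?thesis by (auto simp add: extend_entry_def Let_def)
qed

lemma den_update_cell:
  "den w update_cell s (v_table, x) =
    (let j = s (v_size, 0) - Suc (s (v_b, 0)) in if x = j then relax_p s j else s (v_table, x))"
proof -
  define j where "j = s (v_size, 0) - Suc (s (v_b, 0))"
  define t where "t = den w keep_entry (s((v_j, 0) := j))"
  define u where "u = den w extend_entry t"
  have t: "t (a, x) = (s((v_j, 0) := j)) (a, x)" if "a \<noteq> v_new" for a x
    using that by (simp add: t_def den_keep_entry)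
  have t_new: "t (v_new, 0) =
      (if s (v_standard, s (v_p, 0)) \<noteq> 0 \<and> j + s (v_cost, s (v_p, 0)) \<le> s (v_budget, 0)
       then 0 else s (v_table, j))"
    by (simp add: t_def den_keep_entry)
  have u: "u (a, x) = t (a, x)" if "a \<noteq> v_new" "a \<noteq> v_cand" for a x
    unfolding u_def using that by (intro den_unassigned) (simp add: extend_entry_def)
  have "den w update_cell s = u((v_table, u (v_j, 0)) := u (v_new, 0))"
    by (simp add: update_cell_def u_def t_def j_def)
  moreover have "u (v_new, 0) = relax_p s j"
    unfolding u_def den_extend_entry relax_p_def relax_def t_new by (simp only: Let_def t) auto
  ultimately show ?thesis by (simp add: u t flip: j_def)
qed

lemma den_inspect_cell:
  "den w (inspect_cell fund) s (v_answer, 0) =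
    (if 0 < s (v_table, s (v_b, 0)) \<and> s (v_table, s (v_b, 0)) \<le> Suc (s (v_limit, 0)) \<and>
        (s (v_b, 0) + s (v_cost, s (v_p, 0)) \<le> s (v_budget, 0) \<longleftrightarrow> fund)
     then 1 else s (v_answer, 0))"
  by (auto simp add: inspect_cell_def Let_def)

text \<open>Locality: the new entry depends only on the old entries at \<open>j\<close> and
  \<open>j - c\<close>, which makes an update in place possible.\<close>

lemma relax_cong:
  "d j = d' j \<Longrightarrow> (c \<le> j \<Longrightarrow> d (j - c) = d' (j - c)) \<Longrightarrow>
    relax std c u B d j = relax std c u B d' j"
  unfolding relax_def by (cases "c \<le> j") simp_all

lemma den_update_cells:
  assumes "s (v_size, 0) = length w" "0 < s (v_cost, s (v_p, 0))"
  shows "den w (For v_b update_cell) s (v_table, x) =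
    (if x < length w then relax_p s x else s (v_table, x))"
\<comment> \<open>After \<open>i\<close> rounds exactly the top \<open>i\<close> cells are new. The
  next cell j and the cell j - c lie below them and are still old.\<close>
proof (rule For_induct[where R = "\<lambda>i t. (\<forall>x. t (v_table, x) =
      (if length w - i \<le> x \<and> x < length w then relax_p s x else s (v_table, x))) \<and>
      (\<forall>a x. a \<notin> assigned (For v_b update_cell) \<longrightarrow> t (a, x) = s (a, x))"], goal_cases)
  case (2 i t)
  define u where "u = t((v_b, 0) := i)"
  define j where "j = length w - Suc i"
  have same: "u (a, x) = s (a, x)" if "a \<notin> assigned (For v_b update_cell)" for a x
    using 2 that by (auto simp: u_def)
  have frame: "u (v_size, 0) = length w" "u (v_p, 0) = s (v_p, 0)"
    "u (v_cost, x) = s (v_cost, x)" "u (v_weight, x) = s (v_weight, x)"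
    "u (v_standard, x) = s (v_standard, x)" "u (v_budget, 0) = s (v_budget, 0)" for x
    by (simp_all add: same program_defs assms(1))
  have b: "u (v_b, 0) = i" by (simp add: u_def)
  have table: "u (v_table, x) =
    (if length w - i \<le> x \<and> x < length w then relax_p s x else s (v_table, x))" for x
    using 2 by (simp add: u_def)
  have "relax_p u j = relax_p s j"
    unfolding relax_p_def frame
    by (rule relax_cong) (use 2(1) assms(2) in \<open>auto simp: table j_def\<close>)
  then have "den w update_cell u (v_table, x) =
    (if length w - Suc i \<le> x \<and> x < length w then relax_p s x else s (v_table, x))" for x
    using 2(1) unfolding den_update_cell frame b Let_def j_def table by auto
  moreover have "den w update_cell u (a, x) = s (a, x)"
    if "a \<notin> assigned (For v_b update_cell)" for a x
    using that by (subst den_unassigned) (auto simp: same)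
  ultimately show ?case by (simp add: u_def)
qed auto

lemma den_inspect_cells:
  "den w (For v_b (inspect_cell fund)) s (v_answer, 0) \<noteq> 0 \<longleftrightarrow> s (v_answer, 0) \<noteq> 0 \<or>
    (\<exists>j<length w. 0 < s (v_table, j) \<and> s (v_table, j) \<le> Suc (s (v_limit, 0)) \<and>
        (j + s (v_cost, s (v_p, 0)) \<le> s (v_budget, 0) \<longleftrightarrow> fund))"
proof (rule For_induct[where R = "\<lambda>i t. (t (v_answer, 0) \<noteq> 0 \<longleftrightarrow> s (v_answer, 0) \<noteq> 0 \<or>
    (\<exists>j<i. 0 < s (v_table, j) \<and> s (v_table, j) \<le> Suc (s (v_limit, 0)) \<and>
        (j + s (v_cost, s (v_p, 0)) \<le> s (v_budget, 0) \<longleftrightarrow> fund))) \<and>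
      (\<forall>a x. a \<notin> assigned (For v_b (inspect_cell fund)) \<longrightarrow> t (a, x) = s (a, x))"], goal_cases)
  case (2 i t)
  define u where "u = t((v_b, 0) := i)"
  have same: "u (a, x) = s (a, x)" if "a \<notin> assigned (For v_b (inspect_cell fund))" for a x
    using 2 that by (auto simp: u_def)
  have frame: "u (v_p, 0) = s (v_p, 0)" "u (v_table, x) = s (v_table, x)"
    "u (v_cost, x) = s (v_cost, x)" "u (v_limit, 0) = s (v_limit, 0)"
    "u (v_budget, 0) = s (v_budget, 0)" for x
    by (simp_all add: same inspect_cell_def Let_def)
  have b: "u (v_b, 0) = i" by (simp add: u_def)
  have "u (v_answer, 0) = t (v_answer, 0)" by (simp add: u_def)
  then have "den w (inspect_cell fund) u (v_answer, 0) \<noteq> 0 \<longleftrightarrow> s (v_answer, 0) \<noteq> 0 \<or>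
    (\<exists>j<Suc i. 0 < s (v_table, j) \<and> s (v_table, j) \<le> Suc (s (v_limit, 0)) \<and>
        (j + s (v_cost, s (v_p, 0)) \<le> s (v_budget, 0) \<longleftrightarrow> fund))"
    using 2(2) unfolding den_inspect_cell frame b by (auto simp: less_Suc_eq)
  moreover have "den w (inspect_cell fund) u (a, x) = s (a, x)"
    if "a \<notin> assigned (For v_b (inspect_cell fund))" for a x
    using that by (subst den_unassigned) (auto simp: same)
  ultimately show ?case by (simp add: u_def)
qed auto

section \<open>Invariant of the control program\<close>

text \<open>Projects are identified with their positions in the tie-breaking order.\<close>

definition stores_input :: "('p, 'v) control_input \<Rightarrow> nat \<Rightarrow> store \<Rightarrow> bool" where
  "stores_input I m s \<longleftrightarrow>
     s (v_size, 0) = m \<and> s (v_budget, 0) = budget I \<and> s (v_limit, 0) = limit I \<and>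
     s (v_count, 0) = length (tie I) \<and>
     s (v_target, 0) < length (tie I) \<and> tie I ! s (v_target, 0) = target I \<and>
     (\<forall>i<length (tie I).
       (s (v_standard, i) \<noteq> 0 \<longleftrightarrow> tie I ! i \<in> projects I) \<and>
       s (v_cost, i) = cost I (tie I ! i) \<and>
       s (v_weight, i) = weight I (tie I ! i) \<and>
       s (v_score, i) = approval_score I (tie I ! i))"

text \<open>The answer is tied to the target having occurred: on a prefix without it,
  \<open>controllable\<close> with \<open>fund\<close> false already holds through the empty set of
  spoilers.\<close>

definition progress :: "('p, 'v) control_input \<Rightarrow> bool \<Rightarrow> nat \<Rightarrow> nat list \<Rightarrow> store \<Rightarrow> bool" where
  "progress I fund m is s \<longleftrightarrow> stores_input I m s \<and>
     table_for I (map ((!) (tie I)) is) (\<lambda>j. s (v_table, j)) \<and>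
     (s (v_answer, 0) \<noteq> 0 \<longleftrightarrow>
       target I \<in> set (map ((!) (tie I)) is) \<and> controllable I fund (map ((!) (tie I)) is))"

text \<open>Arrays 1 to 11 are those from \<open>v_mode\<close> to \<open>v_score\<close>; the
  control phase does not write them.\<close>

lemma stores_input_cong:
  assumes "stores_input I m s" "\<And>a x. 1 \<le> a \<Longrightarrow> a \<le> 11 \<Longrightarrow> s' (a, x) = s (a, x)"
  shows "stores_input I m s'"
  using assms by (simp add: stores_input_def)

lemma progress_process:
  assumes wf: "wf_control I"
    and m: "sum_list (map (cost I) (tie I)) < m" "m = length w"
    and s: "progress I fund m is s" "s (v_p, 0) = p"
    and p: "p < length (tie I)" "p \<notin> set is" "set is \<subseteq> {..<length (tie I)}" "distinct is"
  shows "progress I fund m (is @ [p]) (den w (process fund) s)"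
proof -
  define q where "q = tie I ! p"
  define xs where "xs = map ((!) (tie I)) is"
  have inp: "stores_input I m s" and table: "table_for I xs (\<lambda>j. s (v_table, j))"
    and answer: "s (v_answer, 0) \<noteq> 0 \<longleftrightarrow> target I \<in> set xs \<and> controllable I fund xs"
    using s(1) by (simp_all add: progress_def xs_def)
  have tie: "distinct (tie I)" "set (tie I) = projects I \<union> spoilers I"
    and disj: "projects I \<inter> spoilers I = {}" and target: "target I \<in> projects I"
    using wf by (simp_all add: wf_control_def)
  have q_in: "q \<in> projects I \<union> spoilers I" using p(1) tie(2) by (auto simp: q_def)
  then have "0 < cost I q"
    using wf by (auto simp: wf_control_def wf_pb_def with_spoilers_def Suc_le_eq)
  have dist: "distinct (xs @ [q])"
    using p tie(1) unfolding xs_def q_def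
    by (auto simp: distinct_map inj_on_def nth_eq_iff_index_eq subset_iff)
  have "set (xs @ [q]) \<subseteq> set (tie I)"
    using p(1,3) by (auto simp: xs_def q_def)
  then have "sum (cost I) (set (xs @ [q])) \<le> sum (cost I) (set (tie I))"
    by (intro sum_mono2) auto
  \<comment> \<open>The projects of the prefix are distinct members of the tie-breaking list, so all
    attainable amounts, before and after this project, are indices below \<open>m\<close>.\<close>
  then have small: "sum_list (map (cost I) (xs @ [q])) < m"
    using m(1) dist tie(1) sum_list_distinct_conv_sum_set[of "xs @ [q]" "cost I"]
      sum_list_distinct_conv_sum_set[of "tie I" "cost I"] by simp
  have stored: "s (v_standard, p) \<noteq> 0 \<longleftrightarrow> q \<in> projects I" "s (v_cost, p) = cost I q"
    "s (v_weight, p) = weight I q" "s (v_budget, 0) = budget I" "s (v_limit, 0) = limit I"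
    "s (v_size, 0) = length w"
    using inp p(1) m(2) by (simp_all add: stores_input_def q_def)
  have is_target: "s (v_target, 0) = p \<longleftrightarrow> q = target I"
    using inp p(1) nth_eq_iff_index_eq[OF tie(1), of "s (v_target, 0)" p]
    by (auto simp: stores_input_def q_def)
  define s1 where "s1 = den w (if_equal (Var v_p) (Var v_target) (For v_b (inspect_cell fund))) s"
  have s1: "s1 (a, x) = s (a, x)" if "a \<noteq> v_answer" "a \<noteq> v_b" for a x
    unfolding s1_def using that
    by (intro den_unassigned) (simp add: inspect_cell_def Let_def)
  have answer1: "s1 (v_answer, 0) \<noteq> 0 \<longleftrightarrow>
      target I \<in> set (xs @ [q]) \<and> controllable I fund (xs @ [q])"
  proof (cases "q = target I")
    case True
    then have "s1 = den w (For v_b (inspect_cell fund)) s"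
      using is_target s(2) by (simp add: s1_def del: den.simps(5))
    moreover have "s (v_answer, 0) = 0" using answer dist True by simp
    moreover have "0 < s (v_table, j) \<and> s (v_table, j) \<le> Suc v \<longleftrightarrow> attainable I xs j v" for j v
      using table by (simp add: table_for_def)
    ultimately have "s1 (v_answer, 0) \<noteq> 0 \<longleftrightarrow>
      (\<exists>j<length w. attainable I xs j (limit I) \<and> (j + cost I q \<le> budget I \<longleftrightarrow> fund))"
      by (simp only: den_inspect_cells stored s(2) conj_assoc[symmetric]) simp
    also have "\<dots> \<longleftrightarrow>
      (\<exists>j. attainable I xs j (limit I) \<and> (j + cost I q \<le> budget I \<longleftrightarrow> fund))"
    proof -
      have "j < length w" if "attainable I xs j v" for j v
        using attainable_le[OF that] small m(2) by simp
      then show ?thesis by blast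
    qed
    also have "\<dots> \<longleftrightarrow> controllable I fund (xs @ [target I])"
      unfolding True using dist target disj
      by (intro controllable_snoc_target[symmetric]) (auto simp: True)
    finally show ?thesis using True by simp
  next
    case False
    then have "s1 = s"
      using is_target s(2) by (auto simp: s1_def simp del: den.simps(5))
    then show ?thesis
      using answer False dist controllable_snoc_other[of q I xs fund] by simp
  qed
  define s2 where "s2 = den w (For v_b update_cell) s1"
  have s2: "s2 (a, x) = s1 (a, x)" if "a \<notin> {v_table, v_b, v_j, v_new, v_cand}" for a x
    unfolding s2_def using that by (intro den_unassigned) (simp add: program_defs)
  have relax: "relax_p s1 = relax (q \<in> projects I) (cost I q) (weight I q) (budget I)
      (\<lambda>j. s (v_table, j))"
    using stored(1) by (simp add: relax_p_def s1 s(2) stored(2-4))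
  have table2: "table_for I (xs @ [q]) (relax_p s1)"
    unfolding relax using dist by (intro table_for_relax[OF table _ q_in disj]) simp
  \<comment> \<open>The loop updates only cells below \<open>length w\<close>; beyond, the old and
    the new table both vanish because of \<open>small\<close>.\<close>
  have "s2 (v_table, x) = relax_p s1 x" for x
  proof -
    have "s2 (v_table, x) = (if x < length w then relax_p s1 x else s (v_table, x))"
      unfolding s2_def using \<open>0 < cost I q\<close>
      by (subst den_update_cells) (simp_all add: s1 s(2) stored)
    moreover have "relax_p s1 x = 0" "s (v_table, x) = 0" if "length w \<le> x"
      using table_for_eq_0[OF table2, of x] table_for_eq_0[OF table, of x] small m(2) that
      by simp_all
    ultimately show ?thesis by simp
  qed
  then have "(\<lambda>j. s2 (v_table, j)) = relax_p s1" by auto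
  moreover have "stores_input I m s2"
    by (rule stores_input_cong[OF inp]) (simp add: s1 s2)
  moreover have "s2 (v_answer, 0) = s1 (v_answer, 0)" by (simp add: s2)
  moreover have "den w (process fund) s = s2"
    by (simp only: process_def den.simps(3) s1_def s2_def)
  ultimately show ?thesis
    using table2 answer1 by (simp add: progress_def xs_def q_def)
qed

text \<open>Arrays 0 to 12 comprise the answer, the parsed input and the table. Everything above is
  scratch, in particular the loop counters.\<close>

lemma progress_cong:
  assumes "progress I fund m is s" "\<And>a x. a \<le> 12 \<Longrightarrow> s' (a, x) = s (a, x)"
  shows "progress I fund m is s'"
  using assms stores_input_cong[of I m s s'] by (simp add: progress_def)

text \<open>The part of bucket \<open>a\<close> met by the inner loop after \<open>k\<close> rounds,
  needed to state the invariant in mid-bucket.\<close>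

definition visited :: "('p, 'v) control_input \<Rightarrow> nat \<Rightarrow> nat \<Rightarrow> nat \<Rightarrow> nat list" where
  "visited I m a k =
     filter (\<lambda>p. p < length (tie I) \<and> approval_score I (tie I ! p) + a + 1 = m) [0..<k]"

lemma progress_visits:
  assumes wf: "wf_control I"
    and m: "sum_list (map (cost I) (tie I)) < m" "m = length w" "length (tie I) \<le> m"
    and init: "progress I fund m [] s"
  shows "progress I fund m
    (bucket_order m (length (tie I)) (\<lambda>i. approval_score I (tie I ! i)))
    (den w (For v_a (For v_p (visit fund))) s)"
proof -
  define seen where "seen a = concat (map (\<lambda>a. visited I m a m) [0..<a])" for a
  have final: "bucket_order m (length (tie I)) (\<lambda>i. approval_score I (tie I ! i)) = seen m"
  proof -
    have "visited I m a m =
      filter (\<lambda>p. approval_score I (tie I ! p) + a + 1 = m) [0..<length (tie I)]" for a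
    proof -
      \<comment> \<open>Positions from \<open>length (tie I)\<close> on belong to no project, so
        cutting the range there changes no bucket.\<close>
      have "[0..<m] = [0..<length (tie I)] @ [length (tie I)..<m]"
        using m(3) by (metis le0 le_Suc_ex upt_add_eq_append)
      then show ?thesis
        by (auto simp: visited_def filter_empty_conv intro!: filter_cong)
    qed
    then show ?thesis by (simp add: bucket_order_def seen_def)
  qed
  have set_seen: "p \<in> set (seen a) \<Longrightarrow>
      p < length (tie I) \<and> (\<exists>a'<a. approval_score I (tie I ! p) + a' + 1 = m)" for p a
    by (auto simp: seen_def visited_def)
  \<comment> \<open>Different rounds collect different scores, so no project is processed
    twice.\<close>
  have dist: "distinct (seen a @ visited I m a k)" for a k
  proof (induction a arbitrary: k)
    case 0
    then show ?case by (simp add: seen_def visited_def)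
  next
    case (Suc a)
    have "seen (Suc a) = seen a @ visited I m a m" by (simp add: seen_def)
    then have "distinct (seen (Suc a))" using Suc[of m] by simp
    moreover have "set (seen (Suc a)) \<inter> set (visited I m (Suc a) k) = {}"
    proof (rule equals0I)
      fix p
      assume p: "p \<in> set (seen (Suc a)) \<inter> set (visited I m (Suc a) k)"
      then obtain a' where "a' < Suc a" "approval_score I (tie I ! p) + a' + 1 = m"
        using set_seen by blast
      moreover have "approval_score I (tie I ! p) + Suc a + 1 = m"
        using p by (simp add: visited_def)
      ultimately show False by linarith
    qed
    moreover have "distinct (visited I m (Suc a) k)" by (simp add: visited_def)
    ultimately show ?case by simp
  qed
  have inner: "progress I fund m (seen (Suc a)) (den w (For v_p (visit fund)) s)"
    if "progress I fund m (seen a) s" "s (v_a, 0) = a" for a s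
  proof (rule For_induct[where R = "\<lambda>k s. progress I fund m (seen a @ visited I m a k) s \<and>
      s (v_a, 0) = a"], goal_cases)
    case 1
    then show ?case using that by (simp add: visited_def)
  next
    case (2 k t)
    define u where "u = t((v_p, 0) := k)"
    have u: "progress I fund m (seen a @ visited I m a k) u" "u (v_a, 0) = a" "u (v_p, 0) = k"
      using 2 progress_cong[of I fund m _ t u] by (auto simp: u_def)
    then have inp: "u (v_count, 0) = length (tie I)" "u (v_size, 0) = m"
      "k < length (tie I) \<Longrightarrow> u (v_score, k) = approval_score I (tie I ! k)"
      by (simp_all add: progress_def stores_input_def)
    have "den w (visit fund) u (v_a, 0) = a"
      using u(2) by (subst den_unassigned) (simp_all add: program_defs)
    moreover have "progress I fund m (seen a @ visited I m a (Suc k)) (den w (visit fund) u)"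
    proof (cases "k < length (tie I) \<and> approval_score I (tie I ! k) + a + 1 = m")
      case True
      then have "den w (visit fund) u = den w (process fund) u"
        using u inp by (simp add: visit_def)
      moreover have "visited I m a (Suc k) = visited I m a k @ [k]"
        using True by (simp add: visited_def)
      moreover have "k \<notin> set (seen a @ visited I m a k)"
      proof -
        have "k \<notin> set (seen a)"
        proof
          assume "k \<in> set (seen a)"
          then obtain a' where "a' < a" "approval_score I (tie I ! k) + a' + 1 = m"
            using set_seen by blast
          then show False using True by linarith
        qed
        then show ?thesis by (simp add: visited_def)
      qed
      moreover have "set (seen a @ visited I m a k) \<subseteq> {..<length (tie I)}"
        using set_seen by (fastforce simp: visited_def)
      ultimately show ?thesis
        using progress_process[OF wf m(1,2) u(1,3) _ _ _ dist] True by simp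
    next
      case False
      then have "den w (visit fund) u = u"
        using u inp by (auto simp: visit_def)
      moreover have "visited I m a (Suc k) = visited I m a k"
        using False by (simp add: visited_def)
      ultimately show ?thesis using u(1) by simp
    qed
    ultimately show ?case by (simp add: u_def)
  next
    case (3 t)
    have "seen (Suc a) = seen a @ visited I m a (length w)"
      by (simp add: seen_def m(2))
    then have "progress I fund m (seen (Suc a)) t" using 3 by simp
    then show ?case by (rule progress_cong) simp
  qed
  show ?thesis unfolding final
  proof (rule For_induct[where R = "\<lambda>a s. progress I fund m (seen a) s"], goal_cases)
    case 1
    then show ?case using init by (simp add: seen_def)
  next
    case (2 a t)
    have "progress I fund m (seen a) (t((v_a, 0) := a))"
      by (rule progress_cong[OF 2(2)]) simp
    then show ?case by (rule inner) simp
  next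
    case (3 t)
    then have "progress I fund m (seen m) t" by (simp add: m(2))
    then show ?case by (rule progress_cong) simp
  qed
qed

lemma den_control_program:
  assumes "wf_control I" "encodes I w"
  shows "den w (control_program fund) (\<lambda>_. 0) (0, 0) \<noteq> 0 \<longleftrightarrow>
    controllable I fund (project_order I)"
proof -
  define s where "s = den w (For v_a parse_body) (\<lambda>_. 0)"
  define t where "t = s((v_table, 0) := 1)"
  have "target I \<in> set (tie I)" using assms(1) by (auto simp: wf_control_def)
  note parsed = parse_encodes[OF assms(2) this] and len = encodes_length[OF assms(2)]
  note view = den_parse[of w, folded s_def]
  have "stores_input I (length w) s"
    using parsed view unfolding view(1)[symmetric]
    by (simp add: stores_input_def parse_view_def)
  then have "stores_input I (length w) t"
    by (rule stores_input_cong) (auto simp: t_def)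
  moreover have "(\<lambda>j. t (v_table, j)) = (\<lambda>_. 0)(0 := 1)"
    by (auto simp: t_def view)
  ultimately have "progress I fund (length w) [] t"
    using table_for_Nil[of I] by (simp add: progress_def) (simp add: t_def view)
  then have "progress I fund (length w)
    (bucket_order (length w) (length (tie I)) (\<lambda>i. approval_score I (tie I ! i)))
    (den w (For v_a (For v_p (visit fund))) t)"
    using len by (intro progress_visits assms(1)) simp_all
  moreover have "den w (control_program fund) (\<lambda>_. 0) = den w (For v_a (For v_p (visit fund))) t"
    by (simp add: control_program_def s_def t_def del: den.simps(5))
  moreover have "map ((!) (tie I)) (bucket_order (length w) (length (tie I))
      (\<lambda>i. approval_score I (tie I ! i))) = project_order I"
    using len(3) by (intro project_order_bucket[symmetric])
  \<comment> \<open>On the complete order the target has occurred, so the answer flag means exactly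
    \<open>controllable\<close>.\<close>
  moreover have "target I \<in> set (project_order I)"
    using \<open>target I \<in> set (tie I)\<close> by (simp add: project_order_def)
  ultimately show ?thesis by (simp only: progress_def) simp
qed

theorem theorem7:
  "poly_time_solvable (cc_ac_inputs greedy_av) (cc_ac greedy_av)
     (encodes :: (nat, nat) control_input \<Rightarrow> symbol list \<Rightarrow> bool) \<and>
   poly_time_solvable (dc_ac_inputs greedy_av) (dc_ac greedy_av)
     (encodes :: (nat, nat) control_input \<Rightarrow> symbol list \<Rightarrow> bool)"
proof
  show "poly_time_solvable (cc_ac_inputs greedy_av) (cc_ac greedy_av)
     (encodes :: (nat, nat) control_input \<Rightarrow> symbol list \<Rightarrow> bool)"
    by (rule poly_time_solvable_if_den[OF ok_control_program[of True]])
      (simp only: cc_ac_inputs_def mem_Collect_eq den_control_program controllable_project_order)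
  show "poly_time_solvable (dc_ac_inputs greedy_av) (dc_ac greedy_av)
     (encodes :: (nat, nat) control_input \<Rightarrow> symbol list \<Rightarrow> bool)"
    by (rule poly_time_solvable_if_den[OF ok_control_program[of False]])
      (simp only: dc_ac_inputs_def mem_Collect_eq den_control_program controllable_project_order)
qed

end
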